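(* Let $T$ be a tree with $\kappa_{\mathrm m}(T)=2$, and suppose that $H=R\cup U$ (disjoint union) is a disconnected graph generalized cospectral with $T$, where $R$ is a tree and $U$ is a connected bipartite unicyclic graph. Let $C=C_{2\ell}$, $\ell\ge2$, be the unique cycle of $U$, and put $F:=U-V(C)$. Then the following hold. (i) The nullity of $U$ satisfies $$\eta(U)\in\{|V(U)|-2\nu(U),\ |V(U)|-2\nu(U)+2\}.$$ Moreover, $\nu(T)-\nu(R)\in\{\nu(U),\,\nu(U)-1\}$. (ii) Put $s:=\nu(F)$. The exceptional case $\eta(U)=|V(U)|-2\nu(U)+2$ occurs if and only if $$\nu(U)=\ell+s,\qquad \ell\equiv0\pmod 2,\qquad m_{\nu(U)}(U)=2m_s(F).$$ Equivalently, $\nu(T)-\nu(R)=\nu(U)-1$ if and only if these three conditions hold. Otherwise, $\nu(T)-\nu(R)=\nu(U)$.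
   Context: All graphs are finite, simple and undirected. For a graph $X$, $A(X)$ is its adjacency matrix, $\phi_X(x)=\det(xI-A(X))$, $\eta(X)$ is the multiplicity of $0$ as an adjacency eigenvalue, $\nu(X)$ is the matching number, and $m_k(X)$ is the number of $k$-matchings (with $m_0(X)=1$). Two graphs are generalized cospectral if they have the same adjacency spectrum and their complements have the same adjacency spectrum. An adjacency eigenvalue is main if its eigenspace is not orthogonal to the all-one vector; the main polynomial $M_X(x)$ is the product of $(x-\lambda)$ over the distinct main eigenvalues $\lambda$ of $X$ (it divides $\phi_X$ in $\mathbb Z[x]$). If $\phi_X=\prod_{i=1}^r f_i^{m_i}$ with $f_i$ distinct, monic and irreducible over $\mathbb Q$, the main-factor multiplicity is $\kappa_{\mathrm m}(X):=\sum_{i:\,f_i\mid M_X} m_i$. A connected graph is unicyclic if it contains exactly one cycle. $U-V(C)$ is $U$ with all vertices of $C$ deleted. *)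

theory Defs
  imports "Jordan_Normal_Form.Char_Poly" "HOL-Computational_Algebra.Field_as_Ring"
begin

section \<open>Graphs\<close>

record 'a ugraph =
  verts :: "'a set"
  edges :: "'a set set"

definition simple_graph :: "'a ugraph \<Rightarrow> bool" where
  "simple_graph X \<longleftrightarrow> finite (verts X) \<and> (\<forall>e\<in>edges X. e \<subseteq> verts X \<and> card e = 2)"

definition graph_complement :: "'a ugraph \<Rightarrow> 'a ugraph" where
  "graph_complement X =
     \<lparr>verts = verts X,
      edges = {{u, v} | u v. u \<in> verts X \<and> v \<in> verts X \<and> u \<noteq> v \<and> {u, v} \<notin> edges X}\<rparr>"

definition graph_union :: "'a ugraph \<Rightarrow> 'a ugraph \<Rightarrow> 'a ugraph" where
  "graph_union X Y = \<lparr>verts = verts X \<union> verts Y, edges = edges X \<union> edges Y\<rparr>"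

definition delete_verts :: "'a ugraph \<Rightarrow> 'a set \<Rightarrow> 'a ugraph" where
  "delete_verts X S = \<lparr>verts = verts X - S, edges = {e \<in> edges X. e \<inter> S = {}}\<rparr>"

definition adjacent :: "'a ugraph \<Rightarrow> ('a \<times> 'a) set" where
  "adjacent X = {(u, v). {u, v} \<in> edges X}"

text \<open>The null graph (no vertices) does not count as connected, so a tree is nonempty.\<close>

definition connected_graph :: "'a ugraph \<Rightarrow> bool" where
  "connected_graph X \<longleftrightarrow>
     verts X \<noteq> {} \<and> (\<forall>u\<in>verts X. \<forall>v\<in>verts X. (u, v) \<in> (adjacent X)\<^sup>*)"

text \<open>Cycles are subgraphs, not vertex sequences: rotating or reversing the list \<open>vs\<close>
  yields the same cycle, so cycles can be counted.\<close>

definition cycle_in :: "'a ugraph \<Rightarrow> 'a ugraph \<Rightarrow> bool" where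
  "cycle_in C X \<longleftrightarrow>
     verts C \<subseteq> verts X \<and> edges C \<subseteq> edges X \<and>
     (\<exists>vs. distinct vs \<and> length vs \<ge> 3 \<and> verts C = set vs \<and>
        edges C = {{vs ! i, vs ! (Suc i mod length vs)} | i. i < length vs})"

definition tree_graph :: "'a ugraph \<Rightarrow> bool" where
  "tree_graph X \<longleftrightarrow> connected_graph X \<and> \<not> (\<exists>C. cycle_in C X)"

definition unicyclic :: "'a ugraph \<Rightarrow> bool" where
  "unicyclic X \<longleftrightarrow> connected_graph X \<and> (\<exists>!C. cycle_in C X)"

definition bipartite :: "'a ugraph \<Rightarrow> bool" where
  "bipartite X \<longleftrightarrow>
     (\<exists>A B. A \<union> B = verts X \<and> A \<inter> B = {} \<and>
        (\<forall>e\<in>edges X. \<exists>a\<in>A. \<exists>b\<in>B. e = {a, b}))"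

section \<open>Matchings\<close>

definition matching :: "'a ugraph \<Rightarrow> 'a set set \<Rightarrow> bool" where
  "matching X M \<longleftrightarrow> M \<subseteq> edges X \<and> (\<forall>e\<in>M. \<forall>f\<in>M. e \<noteq> f \<longrightarrow> e \<inter> f = {})"

definition num_matchings :: "'a ugraph \<Rightarrow> nat \<Rightarrow> nat" where
  "num_matchings X k = card {M. matching X M \<and> card M = k}"

definition matching_number :: "'a ugraph \<Rightarrow> nat" where
  "matching_number X = Max {card M | M. matching X M}"

section \<open>Adjacency spectrum\<close>

text \<open>The matrix depends on an arbitrary enumeration of the (finite) vertex set. Another
  enumeration conjugates it by a permutation matrix, which preserves the characteristic
  polynomial and the all-one vector, hence everything derived from it below.\<close>

definition vertex_list :: "'a ugraph \<Rightarrow> 'a list" where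
  "vertex_list X = (SOME vs. distinct vs \<and> set vs = verts X)"

definition adj_matrix :: "'a ugraph \<Rightarrow> 'r::zero_neq_one mat" where
  "adj_matrix X =
     mat (card (verts X)) (card (verts X))
       (\<lambda>(i, j). if {vertex_list X ! i, vertex_list X ! j} \<in> edges X then 1 else 0)"

text \<open>The multiset of eigenvalues with multiplicity; since the matrix is real symmetric,
  all roots of its characteristic polynomial are real and algebraic and geometric
  multiplicities coincide.\<close>

definition adj_spectrum :: "'a ugraph \<Rightarrow> real multiset" where
  "adj_spectrum X = proots (char_poly (adj_matrix X))"

definition generalized_cospectral :: "'a ugraph \<Rightarrow> 'b ugraph \<Rightarrow> bool" where
  "generalized_cospectral X Y \<longleftrightarrow>
     adj_spectrum X = adj_spectrum Y \<and>
     adj_spectrum (graph_complement X) = adj_spectrum (graph_complement Y)"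

definition nullity :: "'a ugraph \<Rightarrow> nat" where
  "nullity X = count (adj_spectrum X) 0"

section \<open>Main eigenvalues\<close>

definition main_eigenvalue :: "'a ugraph \<Rightarrow> real \<Rightarrow> bool" where
  "main_eigenvalue X lam \<longleftrightarrow>
     (\<exists>v. eigenvector (adj_matrix X) v lam \<and> v \<bullet> vec (card (verts X)) (\<lambda>_. 1) \<noteq> 0)"

definition main_poly :: "'a ugraph \<Rightarrow> real poly" where
  "main_poly X = (\<Prod>lam\<in>{lam. main_eigenvalue X lam}. [:- lam, 1:])"

text \<open>Divisibility of the main polynomial by a rational factor is tested over the reals.
  As the main polynomial has integer coefficients, this agrees with divisibility over
  the rationals.\<close>

definition main_factor_multiplicity :: "'a ugraph \<Rightarrow> nat" where
  "main_factor_multiplicity X =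
     (\<Sum>f\<in>{f :: rat poly. irreducible f \<and> lead_coeff f = 1 \<and>
             f dvd char_poly (adj_matrix X) \<and> map_poly of_rat f dvd main_poly X}.
        multiplicity f (char_poly (adj_matrix X)))"

end

theory Submission
  imports Defs "HOL-Combinatorics.Cycles" "HOL-Computational_Algebra.Fundamental_Theorem_Algebra"
begin

text \<open>In the Leibniz expansion of \<open>det (x I - A)\<close> only those permutations survive that fix each
  vertex or move it along an edge. The involutions among them are the matchings; any other one rotates a cycle of the graph.
  So a tree has the matching polynomial as its characteristic polynomial, while for \<open>U\<close> one
  has to subtract twice the matching polynomial of \<open>F\<close>, once for each orientation of \<open>C\<close>.
  The coefficient of \<open>x\<close> to the power \<open>|V(U)| - 2k\<close> is therefore, up to sign,
  \<open>m\<^sub>k(U) - 2 (-1)\<^sup>l m\<^sub>k\<^sub>-\<^sub>l(F)\<close>. For \<open>k = \<nu>(U)\<close> it vanishes exactly in the exceptional case, and then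
  the one for \<open>k = \<nu>(U) - 1\<close> does not, since \<open>m\<^sub>k(U) > 2 m\<^sub>k\<^sub>-\<^sub>l(F)\<close>. The statement on \<open>\<nu>(T) - \<nu>(R)\<close> follows by
  comparing orders and nullities: nullity is additive on disjoint unions, and cospectral graphs have
  equally many vertices because a real symmetric matrix has only real eigenvalues.\<close>

section \<open>Characteristic polynomials of graphs\<close>

lemma order_0_eqI:
  fixes p :: "'a::idom poly"
  assumes "\<And>k. k < d \<Longrightarrow> coeff p k = 0" "coeff p d \<noteq> 0"
  shows "order 0 p = d"
proof -
  have p: "p \<noteq> 0" using assms(2) by auto
  have "monom 1 d dvd p" "\<not> monom 1 (Suc d) dvd p"
    using assms by (auto simp: monom_1_dvd_iff')
  then show ?thesis using p by (simp add: monom_1_dvd_iff)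
qed

text \<open>Splitting off real roots leaves a factor without any. Were it nonconstant, it would have
  a complex root by the fundamental theorem of algebra, and that root is real by assumption.\<close>

lemma size_proots_eq_degree:
  fixes p :: "real poly"
  assumes "\<And>z. poly (map_poly complex_of_real p) z = 0 \<Longrightarrow> z \<in> \<real>"
  shows "size (proots p) = degree p"
  using assms
proof (induction p rule: poly_root_order_induct)
  case (no_roots p)
  have "degree p = 0"
  proof (rule ccontr)
    assume "degree p \<noteq> 0"
    then have "\<not> constant (poly (map_poly complex_of_real p))"
      by (simp add: constant_degree)
    then obtain z where z: "poly (map_poly complex_of_real p) z = 0"
      using fundamental_theorem_of_algebra by blast
    with no_roots.prems obtain x where "z = of_real x" by (auto elim: Reals_cases)
    with z no_roots.hyps show False by simp
  qed
  moreover have "proots p = {#}"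
    using no_roots.hyps by (intro multiset_eqI) (cases "p = 0"; simp add: order_root)
  ultimately show ?case by simp
next
  case (root p x n)
  interpret map_poly_comm_ring_hom complex_of_real ..
  have [simp]: "p \<noteq> 0" using root.hyps by auto
  have "size (proots p) = degree p"
  proof (rule root.IH)
    fix z assume "poly (map_poly complex_of_real p) z = 0"
    then show "z \<in> \<real>"
      by (intro root.prems) (simp only: hom_mult poly_mult mult_zero_right)
  qed
  then show ?case
    by (simp add: proots_mult proots_power degree_mult_eq degree_power_eq)
qed simp

text \<open>By symmetry the Hermitian form of \<open>A\<close> at an eigenvector equals its own
  conjugate; it is also \<open>z\<close> times the squared norm of that vector.\<close>

lemma real_symmetric_char_poly_roots:
  fixes A :: "real mat"
  assumes A: "A \<in> carrier_mat n n" and sym: "\<And>i j. i < n \<Longrightarrow> j < n \<Longrightarrow> A $$ (i,j) = A $$ (j,i)"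
    and z: "poly (map_poly complex_of_real (char_poly A)) z = 0"
  shows "z \<in> \<real>"
proof -
  let ?A = "map_mat complex_of_real A"
  have A': "?A \<in> carrier_mat n n" using A by simp
  have "poly (char_poly ?A) z = 0"
    using z by (simp add: of_real_hom.char_poly_hom[OF A])
  then obtain v where "eigenvector ?A v z"
    using eigenvalue_root_char_poly[OF A'] unfolding eigenvalue_def by blast
  then have v: "v \<in> carrier_vec n" "v \<noteq> 0\<^sub>v n" "?A *\<^sub>v v = z \<cdot>\<^sub>v v"
    using A unfolding eigenvector_def by auto
  have row: "(\<Sum>j<n. complex_of_real (A $$ (i,j)) * v $ j) = z * v $ i" if "i < n" for i
    using arg_cong[OF v(3), of "\<lambda>w. w $ i"] that A v(1)
    by (simp add: scalar_prod_def atLeast0LessThan)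
  define w where "w = (\<Sum>i<n. \<Sum>j<n. complex_of_real (A $$ (i,j)) * v $ j * cnj (v $ i))"
  define N where "N = (\<Sum>i<n. (norm (v $ i))\<^sup>2)"
  have "w = (\<Sum>i<n. z * v $ i * cnj (v $ i))"
    unfolding w_def by (intro sum.cong refl) (simp add: row flip: sum_distrib_right)
  also have "\<dots> = z * of_real N"
    unfolding N_def of_real_sum complex_norm_square sum_distrib_left by (simp add: mult.assoc)
  finally have wz: "w = z * of_real N" .
  have "cnj w = (\<Sum>i<n. \<Sum>j<n. complex_of_real (A $$ (i,j)) * cnj (v $ j) * v $ i)"
    by (simp add: w_def)
  also have "\<dots> = (\<Sum>j<n. \<Sum>i<n. complex_of_real (A $$ (i,j)) * cnj (v $ j) * v $ i)"
    by (rule sum.swap)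
  also have "\<dots> = w"
    unfolding w_def by (intro sum.cong refl) (simp add: sym mult.commute mult.left_commute)
  finally have "cnj w = w" .
  then have "cnj z * of_real N = z * of_real N" unfolding wz by simp
  moreover have "N \<noteq> 0"
  proof
    assume "N = 0"
    then have "\<forall>i<n. v $ i = 0" unfolding N_def by (subst (asm) sum_nonneg_eq_0_iff) auto
    then show False using v(1,2) by (auto intro: eq_vecI)
  qed
  ultimately show ?thesis by (simp add: Reals_cnj_iff)
qed

lemma char_poly_block_diagonal:
  fixes A B :: "'a::idom mat"
  assumes A: "A \<in> carrier_mat n n" and B: "B \<in> carrier_mat m m"
  shows "char_poly (four_block_mat A (0\<^sub>m n m) (0\<^sub>m m n) B) = char_poly A * char_poly B"
proof -
  have "char_poly_matrix (four_block_mat A (0\<^sub>m n m) (0\<^sub>m m n) B) =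
      four_block_mat (char_poly_matrix A) (0\<^sub>m n m) (0\<^sub>m m n) (char_poly_matrix B)"
    using A B by (intro eq_matI) (auto simp: char_poly_matrix_def)
  then show ?thesis unfolding char_poly_def
    using A B by (simp add: det_four_block_mat_lower_left_zero[where n = n and m = m])
qed

text \<open>Carries the Leibniz sum from matrix indices to the vertices themselves: conjugation by
  the enumeration \<open>f\<close> is a sign-preserving bijection of permutations.\<close>

lemma sum_permutes_reindex:
  fixes g :: "'b \<Rightarrow> 'b \<Rightarrow> 'c::comm_ring_1"
  assumes f: "bij_betw f A B" and A: "finite A"
  shows "(\<Sum>p | p permutes A. of_int (sign p) * (\<Prod>i\<in>A. g (f i) (f (p i)))) =
    (\<Sum>p | p permutes B. of_int (sign p) * (\<Prod>v\<in>B. g v (p v)))"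
proof (rule sum.reindex_bij_witness[where j = "map_permutation A f"
      and i = "map_permutation B (inv_into A f)"])
  note inj = bij_betw_imp_inj_on[OF f]
  have B: "f ` A = B" using f by (simp add: bij_betw_def)
  have f': "bij_betw (inv_into A f) B A" using f by (rule bij_betw_inv_into)
  fix p assume "p \<in> {p. p permutes A}"
  then have p: "p permutes A" by simp
  show "map_permutation A f p \<in> {p. p permutes B}"
    using map_permutation_permutes[OF f p] by simp
  show "map_permutation B (inv_into A f) (map_permutation A f p) = p"
  proof
    fix x
    show "map_permutation B (inv_into A f) (map_permutation A f p) x = p x"
      using p B inj f' permutes_in_image[OF p]
      by (auto simp: map_permutation_def bij_betw_def restrict_id_def inv_into_inv_into_eq[OF f] permutes_not_in)
  qed
  have "(\<Prod>v\<in>B. g v (map_permutation A f p v)) = (\<Prod>i\<in>A. g (f i) (f (p i)))"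
    unfolding B[symmetric] using inj
    by (subst prod.reindex) (auto simp: map_permutation_def restrict_id_def intro!: prod.cong)
  then show "of_int (sign (map_permutation A f p)) * (\<Prod>v\<in>B. g v (map_permutation A f p v)) =
     of_int (sign p) * (\<Prod>i\<in>A. g (f i) (f (p i)))"
    using sign_map_permutation[OF inj p A] by simp
next
  note inj = bij_betw_imp_inj_on[OF f]
  have B: "f ` A = B" using f by (simp add: bij_betw_def)
  have f': "bij_betw (inv_into A f) B A" using f by (rule bij_betw_inv_into)
  fix p assume "p \<in> {p. p permutes B}"
  then have p: "p permutes B" by simp
  show "map_permutation B (inv_into A f) p \<in> {p. p permutes A}"
    using map_permutation_permutes[OF f' p] by simp
  show "map_permutation A f (map_permutation B (inv_into A f) p) = p"
  proof
    fix x
    show "map_permutation A f (map_permutation B (inv_into A f) p) x = p x"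
      using p B inj f' permutes_in_image[OF p]
      by (auto simp: map_permutation_def bij_betw_def restrict_id_def inv_into_inv_into_eq[OF f] permutes_not_in f_inv_into_f)
  qed
qed

section \<open>Leibniz expansion of the characteristic polynomial of a graph\<close>

definition edge_perms :: "'a ugraph \<Rightarrow> ('a \<Rightarrow> 'a) set" where
  "edge_perms X = {p. p permutes verts X \<and> (\<forall>v. p v \<noteq> v \<longrightarrow> {v, p v} \<in> edges X)}"

text \<open>The Leibniz term of \<open>p\<close> in \<open>det (x I - A)\<close> on \<open>n\<close>
  vertices, for a permutation moving vertices only along edges: each fixed vertex contributes
  \<open>x\<close>, each moved one \<open>-1\<close>.\<close>

definition perm_weight :: "nat \<Rightarrow> ('a \<Rightarrow> 'a) \<Rightarrow> 'r::comm_ring_1 poly" where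
  "perm_weight n p =
     monom (of_int (sign p) * (-1) ^ card {v. p v \<noteq> v}) (n - card {v. p v \<noteq> v})"

lemma simple_graph_edge_neq: "simple_graph X \<Longrightarrow> {u, v} \<in> edges X \<Longrightarrow> u \<noteq> v"
  by (auto simp: simple_graph_def)

lemma finite_edge_perms: "simple_graph X \<Longrightarrow> finite (edge_perms X)"
  unfolding edge_perms_def simple_graph_def
  by (rule finite_subset[OF _ finite_permutations[of "verts X"]]) auto

text \<open>The enumeration \<open>vs\<close> is arbitrary and the right-hand side does not mention
  it, so any convenient order of the vertices may be used later.\<close>

lemma char_poly_enumerated:
  fixes X :: "'a ugraph"
  assumes X: "simple_graph X" and vs: "distinct vs" "set vs = verts X"
  shows "char_poly (mat (length vs) (length vs)
      (\<lambda>(i, j). if {vs ! i, vs ! j} \<in> edges X then 1 else 0 :: 'r::idom)) =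
    (\<Sum>p\<in>edge_perms X. perm_weight (card (verts X)) p)"
proof -
  let ?n = "length vs" let ?V = "verts X"
  \<comment> \<open>\<open>g\<close> is the matrix \<open>x I - A\<close> indexed by vertices. There
    are no loops, so its diagonal entries are exactly \<open>x\<close>.\<close>
  define g :: "'a \<Rightarrow> 'a \<Rightarrow> 'r poly" where
    "g u v = (if u = v then [:0,1:] else if {u,v} \<in> edges X then -1 else 0)" for u v
  have fin: "finite ?V" using X by (simp add: simple_graph_def)
  have bij: "bij_betw ((!) vs) {0..<?n} ?V"
    using bij_betw_nth[OF vs(1)] vs(2) by (metis atLeast0LessThan)
  let ?M = "mat ?n ?n (\<lambda>(i, j). if {vs ! i, vs ! j} \<in> edges X then 1 else 0 :: 'r)"
  have entry: "char_poly_matrix ?M $$ (i, j) = g (vs ! i) (vs ! j)" if "i < ?n" "j < ?n" for i j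
    using that vs(1) simple_graph_edge_neq[OF X, of "vs ! i" "vs ! i"]
    by (auto simp: char_poly_matrix_def g_def nth_eq_iff_index_eq one_pCons)
  have "char_poly ?M = (\<Sum>p | p permutes {0..<?n}. of_int (sign p) *
      (\<Prod>i\<in>{0..<?n}. g (vs ! i) (vs ! p i)))"
    unfolding char_poly_def
    by (subst det_def'[where n = ?n]) (auto intro!: sum.cong prod.cong simp: entry permutes_in_image
        simp flip: atLeast0LessThan)
  also have "\<dots> = (\<Sum>p | p permutes ?V. of_int (sign p) * (\<Prod>v\<in>?V. g v (p v)))"
    by (rule sum_permutes_reindex[OF bij]) simp
  also have "\<dots> = (\<Sum>p\<in>edge_perms X. of_int (sign p) * (\<Prod>v\<in>?V. g v (p v)))"
  proof (rule sum.mono_neutral_right)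
    show "\<forall>p\<in>{p. p permutes ?V} - edge_perms X. of_int (sign p) * (\<Prod>v\<in>?V. g v (p v)) = 0"
    proof
      fix p assume "p \<in> {p. p permutes ?V} - edge_perms X"
      then obtain v where v: "p permutes ?V" "p v \<noteq> v" "{v, p v} \<notin> edges X"
        by (auto simp: edge_perms_def)
      have "v \<in> ?V" using v(1,2) by (metis permutes_not_in)
      moreover have "g v (p v) = 0" using v by (simp add: g_def)
      ultimately have "(\<Prod>v\<in>?V. g v (p v)) = 0" using fin by (metis prod_zero_iff)
      then show "of_int (sign p) * (\<Prod>v\<in>?V. g v (p v)) = 0" by simp
    qed
  qed (use fin in \<open>auto simp: edge_perms_def finite_permutations\<close>)
  also have "\<dots> = (\<Sum>p\<in>edge_perms X. perm_weight (card ?V) p)"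
  proof (rule sum.cong[OF refl])
    fix p assume p: "p \<in> edge_perms X"
    let ?S = "{v. p v \<noteq> v}"
    have S: "?S \<subseteq> ?V" using p by (auto simp: edge_perms_def dest: permutes_not_in)
    have "(\<Prod>v\<in>?V. g v (p v)) = (\<Prod>v\<in>?V - ?S. g v (p v)) * (\<Prod>v\<in>?S. g v (p v))"
      using prod.subset_diff[OF S fin] .
    also have "(\<Prod>v\<in>?V - ?S. g v (p v)) = (\<Prod>v\<in>?V - ?S. [:0,1:])"
      by (rule prod.cong) (auto simp: g_def)
    also have "(\<Prod>v\<in>?S. g v (p v)) = (\<Prod>v\<in>?S. -1)"
      using p by (intro prod.cong refl) (auto simp: g_def edge_perms_def)
    also have "(\<Prod>v\<in>?V - ?S. [:0,1::'r:]) = monom 1 (card ?V - card ?S)"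
      using S fin by (simp add: card_Diff_subset finite_subset monom_altdef)
    finally show "of_int (sign p) * (\<Prod>v\<in>?V. g v (p v)) = perm_weight (card ?V) p"
      by (simp add: perm_weight_def) (cases p rule: sign_cases;
          cases "even (card ?S)"; simp add: minus_monom)
  qed
  finally show ?thesis .
qed

lemma vertex_list:
  assumes "simple_graph X"
  shows "distinct (vertex_list X)" "set (vertex_list X) = verts X"
proof -
  have "finite (verts X)" using assms by (simp add: simple_graph_def)
  then have "\<exists>vs. distinct vs \<and> set vs = verts X" using finite_distinct_list by blast
  then show "distinct (vertex_list X)" "set (vertex_list X) = verts X"
    unfolding vertex_list_def by (metis (mono_tags, lifting) someI_ex)+
qed

lemma length_vertex_list: "simple_graph X \<Longrightarrow> length (vertex_list X) = card (verts X)"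
  by (metis distinct_card vertex_list)

lemma char_poly_adj_matrix:
  assumes "simple_graph X"
  shows "char_poly (adj_matrix X :: 'r::idom mat) =
    (\<Sum>p\<in>edge_perms X. perm_weight (card (verts X)) p)"
  using char_poly_enumerated[OF assms vertex_list[OF assms]]
  by (simp add: adj_matrix_def length_vertex_list[OF assms])

lemma adj_matrix_carrier: "adj_matrix X \<in> carrier_mat (card (verts X)) (card (verts X))"
  by (simp add: adj_matrix_def)

text \<open>The spectrum only collects real roots, so its full size rests on real-rootedness. It
  makes cospectral graphs have equally many vertices.\<close>

lemma size_adj_spectrum: "size (adj_spectrum X) = card (verts X)"
proof -
  have A: "(adj_matrix X :: real mat) \<in> carrier_mat (card (verts X)) (card (verts X))"
    by (rule adj_matrix_carrier)
  have "size (adj_spectrum X) = degree (char_poly (adj_matrix X :: real mat))"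
    unfolding adj_spectrum_def
  proof (rule size_proots_eq_degree)
    fix z assume "poly (map_poly complex_of_real (char_poly (adj_matrix X))) z = 0"
    then show "z \<in> \<real>"
      by (rule real_symmetric_char_poly_roots[OF A, rotated])
         (simp add: adj_matrix_def insert_commute)
  qed
  then show ?thesis using degree_monic_char_poly[OF A] by simp
qed

text \<open>Listing the vertices of \<open>R\<close> before those of \<open>U\<close> makes the
  adjacency matrix block diagonal, and the characteristic polynomial does not depend on the
  listing.\<close>

lemma char_poly_graph_union:
  assumes R: "simple_graph R" and U: "simple_graph U" and disj: "verts R \<inter> verts U = {}"
  shows "char_poly (adj_matrix (graph_union R U) :: 'r::idom mat) =
    char_poly (adj_matrix R) * char_poly (adj_matrix U)"
proof -
  let ?H = "graph_union R U"
  have H: "simple_graph ?H" using R U by (auto simp: simple_graph_def graph_union_def)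
  let ?r = "vertex_list R" let ?u = "vertex_list U"
  let ?n = "length ?r" let ?m = "length ?u"
  note r = vertex_list[OF R] and u = vertex_list[OF U]
  have e: "e \<subseteq> verts R" if "e \<in> edges R" for e using R that by (auto simp: simple_graph_def)
  have e': "e \<subseteq> verts U" if "e \<in> edges U" for e using U that by (auto simp: simple_graph_def)
  have rn: "?r ! i \<in> verts R" "?r ! i \<notin> verts U" if "i < ?n" for i
    using that r disj nth_mem by blast+
  have un: "?u ! i \<in> verts U" "?u ! i \<notin> verts R" if "i < ?m" for i
    using that u disj nth_mem by blast+
  have A: "adj_matrix R = (mat ?n ?n (\<lambda>(i, j). if {?r ! i, ?r ! j} \<in> edges R then 1 else 0) :: 'r mat)"
    and B: "adj_matrix U = (mat ?m ?m (\<lambda>(i, j). if {?u ! i, ?u ! j} \<in> edges U then 1 else 0) :: 'r mat)"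
    by (simp_all add: adj_matrix_def length_vertex_list R U)
  have nR: "{a, b} \<notin> edges R" if "a \<notin> verts R \<or> b \<notin> verts R" for a b using e that by blast
  have nU: "{a, b} \<notin> edges U" if "a \<notin> verts U \<or> b \<notin> verts U" for a b using e' that by blast
  have "mat (length (?r @ ?u)) (length (?r @ ?u))
      (\<lambda>(i, j). if {(?r @ ?u) ! i, (?r @ ?u) ! j} \<in> edges ?H then 1 else 0 :: 'r) =
    four_block_mat (adj_matrix R) (0\<^sub>m ?n ?m) (0\<^sub>m ?m ?n) (adj_matrix U)"
    unfolding A B
    by (rule eq_matI) (auto simp: nth_append graph_union_def rn un nR nU)
  moreover have "char_poly (adj_matrix ?H :: 'r mat) = char_poly (mat (length (?r @ ?u)) (length (?r @ ?u))
      (\<lambda>(i, j). if {(?r @ ?u) ! i, (?r @ ?u) ! j} \<in> edges ?H then 1 else 0 :: 'r))"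
    unfolding char_poly_adj_matrix[OF H] using r u disj
    by (intro char_poly_enumerated[OF H, symmetric]) (auto simp: graph_union_def)
  ultimately show ?thesis
    using char_poly_block_diagonal[of "adj_matrix R :: 'r mat" ?n "adj_matrix U" ?m]
    by (simp add: adj_matrix_carrier length_vertex_list R U)
qed

lemma char_poly_adj_matrix_nonzero: "(char_poly (adj_matrix X) :: 'r::idom poly) \<noteq> 0"
proof -
  have "(adj_matrix X :: 'r mat) \<in> carrier_mat (card (verts X)) (card (verts X))"
    by (rule adj_matrix_carrier)
  from degree_monic_char_poly[OF this] show ?thesis by auto
qed

lemma nullity_eq_order: "nullity X = order 0 (char_poly (adj_matrix X :: real mat))"
  by (simp add: nullity_def adj_spectrum_def char_poly_adj_matrix_nonzero)

lemma nullity_graph_union: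
  assumes "simple_graph R" "simple_graph U" "verts R \<inter> verts U = {}"
  shows "nullity (graph_union R U) = nullity R + nullity U"
  by (simp add: nullity_eq_order char_poly_graph_union[OF assms] order_mult
      char_poly_adj_matrix_nonzero)

section \<open>Matchings and involutions\<close>

definition edge_involutions :: "'a ugraph \<Rightarrow> ('a \<Rightarrow> 'a) set" where
  "edge_involutions X = {p \<in> edge_perms X. \<forall>v. p (p v) = v}"

text \<open>The classical matching polynomial, summed over matchings instead of sizes so that a
  bijection with involutions applies directly. In a simple graph the subtraction never truncates, by
  \<open>matching_card_le\<close>.\<close>

definition matching_poly :: "'a ugraph \<Rightarrow> 'r::comm_ring_1 poly" where
  "matching_poly X =
     (\<Sum>M | matching X M. monom ((-1) ^ card M) (card (verts X) - 2 * card M))"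

text \<open>Says that \<open>p\<close> is the product of the transpositions given by the edges in
  \<open>M\<close>; sign and number of moved points are recorded along with it for the
  induction.\<close>

definition matching_involution :: "'a set set \<Rightarrow> ('a \<Rightarrow> 'a) \<Rightarrow> bool" where
  "matching_involution M p \<longleftrightarrow>
     p permutes \<Union>M \<and> (\<forall>v. p (p v) = v) \<and> {{v, p v} | v. p v \<noteq> v} = M \<and>
     sign p = (-1) ^ card M \<and> card {v. p v \<noteq> v} = 2 * card M"

text \<open>Induction on \<open>M\<close>: the new edge is disjoint from the others, so
  \<open>p\<close> fixes both its ends. Composing with their transposition flips the sign and adds
  two moved points.\<close>

lemma involution_of_matching:
  assumes "finite M" "\<And>e. e \<in> M \<Longrightarrow> card e = 2"
    "\<And>e f. e \<in> M \<Longrightarrow> f \<in> M \<Longrightarrow> e \<noteq> f \<Longrightarrow> e \<inter> f = {}"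
  shows "\<exists>p. matching_involution M p"
  using assms
proof (induction M rule: finite_induct)
  case empty
  show ?case by (rule exI[of _ id]) (simp add: matching_involution_def permutes_id flip: id_def)
next
  case (insert e M)
  obtain p where "matching_involution M p"
    using insert.IH insert.prems by blast
  then have p: "p permutes \<Union>M" "\<And>v. p (p v) = v" "{{v, p v} | v. p v \<noteq> v} = M"
    "sign p = (-1) ^ card M" "card {v. p v \<noteq> v} = 2 * card M"
    by (simp_all add: matching_involution_def)
  obtain a b where e: "e = {a, b}" "a \<noteq> b" using insert.prems(1)[of e] by (auto simp: card_2_iff)
  have disj: "e \<inter> f = {}" if "f \<in> M" for f
    using insert.prems(2)[of e f] insert.hyps that by auto
  then have ab: "a \<notin> \<Union>M" "b \<notin> \<Union>M" using e by blast+
  have fin: "finite (\<Union>M)"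
    using insert.hyps(1) insert.prems(1) by (intro finite_Union) (auto intro: card_ge_0_finite)
  define q where "q = Transposition.transpose a b \<circ> p"
  have pab: "p a = a" "p b = b" using p(1) ab by (auto simp: permutes_not_in)
  have p_eq: "p v = a \<longleftrightarrow> v = a" "p v = b \<longleftrightarrow> v = b" for v using p(2) pab by metis+
  have q: "q v = (if v = a then b else if v = b then a else p v)" for v
    by (auto simp: q_def pab p_eq Transposition.transpose_def)
  have moved: "{v. q v \<noteq> v} = {a, b} \<union> {v. p v \<noteq> v}" using e(2) pab by (auto simp: q)
  have fin': "finite {v. p v \<noteq> v}"
    by (rule finite_subset[OF _ fin]) (use p(1) in \<open>auto simp: permutes_def\<close>)
  have "q permutes \<Union>(insert e M)"
    unfolding q_def
    by (intro permutes_compose permutes_swap_id permutes_subset[OF p(1)]) (auto simp: e)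
  moreover have "q (q v) = v" for v using e(2) by (simp add: q p(2) p_eq)
  moreover have "{{v, q v} | v. q v \<noteq> v} = insert e M"
  proof -
    have "{{v, q v} | v. q v \<noteq> v} = (\<lambda>v. {v, q v}) ` {v. q v \<noteq> v}" by blast
    also have "\<dots> = insert e ((\<lambda>v. {v, q v}) ` {v. p v \<noteq> v})"
      unfolding moved using e(2) by (auto simp: q e(1) insert_commute)
    also have "(\<lambda>v. {v, q v}) ` {v. p v \<noteq> v} = (\<lambda>v. {v, p v}) ` {v. p v \<noteq> v}"
      using pab by (intro image_cong) (auto simp: q)
    also have "\<dots> = M" using p(3) by blast
    finally show ?thesis .
  qed
  moreover have "sign q = (-1) ^ card (insert e M)"
  proof -
    have "permutation p" using p(1) fin permutation_permutes by blast
    then show ?thesis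
      unfolding q_def using p(4) e(2) insert.hyps
      by (simp add: sign_compose permutation_swap_id sign_swap_id)
  qed
  moreover have "card {v. q v \<noteq> v} = 2 * card (insert e M)"
  proof -
    have "{a, b} \<inter> {v. p v \<noteq> v} = {}" using pab by auto
    from card_Un_disjoint[OF _ fin' this] show ?thesis
      unfolding moved p(5) using e(2) insert.hyps by simp
  qed
  ultimately have "matching_involution (insert e M) q"
    unfolding matching_involution_def by (intro conjI allI)
  then show ?case by (intro exI[of _ q])
qed

lemma matching_finite:
  assumes "simple_graph X" "matching X M"
  shows "finite M"
proof -
  have "M \<subseteq> Pow (verts X)" "finite (verts X)"
    using assms by (auto simp: simple_graph_def matching_def)
  then show ?thesis by (meson finite_Pow_iff finite_subset)
qed

lemma finite_matchings:
  assumes "simple_graph X"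
  shows "finite {M. matching X M}"
proof -
  have "{M. matching X M} \<subseteq> Pow (Pow (verts X))" "finite (verts X)"
    using assms by (auto simp: simple_graph_def matching_def)
  then show ?thesis by (meson finite_Pow_iff finite_subset)
qed

text \<open>An involution is determined by its 2-cycles: a moved point lies in one of them, whose
  other element is its image.\<close>

lemma involution_eqI:
  assumes "\<And>v. p (p v) = v" "\<And>v. q (q v) = v"
    and "{{v, p v} | v. p v \<noteq> v} = {{v, q v} | v. q v \<noteq> v}"
  shows "p = q"
proof
  have move: "g v = f v" if "f v \<noteq> v" "\<And>v. g (g v) = v"
    "{{v, f v} | v. f v \<noteq> v} = {{v, g v} | v. g v \<noteq> v}" for f g :: "'a \<Rightarrow> 'a" and v
  proof -
    have "{v, f v} \<in> {{v, g v} | v. g v \<noteq> v}" using that by blast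
    then obtain w where "{v, f v} = {w, g w}" by blast
    then show ?thesis using that(1,2) by (metis doubleton_eq_iff)
  qed
  fix v
  show "p v = q v"
    using move[of p v q] move[of q v p] assms by metis
qed

lemma bij_betw_involutions_matchings:
  assumes X: "simple_graph X"
  shows "bij_betw (\<lambda>p. {{v, p v} | v. p v \<noteq> v}) (edge_involutions X) {M. matching X M}"
proof (rule bij_betwI')
  fix p q assume "p \<in> edge_involutions X" "q \<in> edge_involutions X"
  then show "({{v, p v} | v. p v \<noteq> v} = {{v, q v} | v. q v \<noteq> v}) = (p = q)"
    using involution_eqI[of p q] by (auto simp: edge_involutions_def)
next
  fix p assume "p \<in> edge_involutions X"
  then have p: "\<And>v. p v \<noteq> v \<Longrightarrow> {v, p v} \<in> edges X" "\<And>v. p (p v) = v"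
    by (auto simp: edge_involutions_def edge_perms_def)
  have "{v, p v} = {w, p w}" if "{v, p v} \<inter> {w, p w} \<noteq> {}" for v w
    using that p(2) by (auto; metis)
  then show "{{v, p v} | v. p v \<noteq> v} \<in> {M. matching X M}"
    using p(1) by (auto simp: matching_def)
next
  fix M assume "M \<in> {M. matching X M}"
  then have M: "M \<subseteq> edges X" "\<And>e f. e \<in> M \<Longrightarrow> f \<in> M \<Longrightarrow> e \<noteq> f \<Longrightarrow> e \<inter> f = {}" "finite M"
    using matching_finite[OF X] by (auto simp: matching_def)
  have "card e = 2" "e \<subseteq> verts X" if "e \<in> M" for e
    using that M(1) X by (auto simp: simple_graph_def)
  note M' = this
  obtain p where "matching_involution M p"
    using involution_of_matching[OF M(3) M'(1) M(2)] by blast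
  then have p: "p permutes \<Union>M" "\<forall>v. p (p v) = v" "{{v, p v} | v. p v \<noteq> v} = M"
    by (simp_all add: matching_involution_def)
  have sub: "\<Union>M \<subseteq> verts X" using M'(2) by blast
  have "{v, p v} \<in> edges X" if "p v \<noteq> v" for v using that p(3) M(1) by blast
  then have "p \<in> edge_involutions X"
    using p permutes_subset[OF p(1) sub] by (simp add: edge_involutions_def edge_perms_def)
  then show "\<exists>p\<in>edge_involutions X. M = {{v, p v} | v. p v \<noteq> v}"
    using p(3) by (intro bexI[of _ p]) simp_all
qed

text \<open>\<open>involution_of_matching\<close> provides an involution with these values, and
  \<open>involution_eqI\<close> identifies it with \<open>p\<close>.\<close>

lemma edge_involution_sign_card:
  assumes X: "simple_graph X" and p: "p \<in> edge_involutions X"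
  defines "M \<equiv> {{v, p v} | v. p v \<noteq> v}"
  shows "sign p = (-1) ^ card M" "card {v. p v \<noteq> v} = 2 * card M"
proof -
  have M: "matching X M"
    using bij_betw_apply[OF bij_betw_involutions_matchings[OF X] p] unfolding M_def by simp
  have "card e = 2" if "e \<in> M" for e
    using that M X by (auto simp: simple_graph_def matching_def)
  then obtain q where "matching_involution M q"
    using involution_of_matching[OF matching_finite[OF X M]] M by (auto simp: matching_def)
  then have q: "\<And>v. q (q v) = v" "{{v, q v} | v. q v \<noteq> v} = M"
    "sign q = (-1) ^ card M" "card {v. q v \<noteq> v} = 2 * card M"
    by (simp_all add: matching_involution_def)
  have "p = q"
    by (rule involution_eqI) (use p in \<open>simp_all add: edge_involutions_def q(1) q(2) M_def\<close>)
  then show "sign p = (-1) ^ card M" "card {v. p v \<noteq> v} = 2 * card M" using q by auto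
qed

text \<open>The number of moved points is \<open>2 * card M\<close>, so the powers of
  \<open>-1\<close> from the matrix entries cancel and only the sign \<open>(-1) ^ card M\<close>
  remains.\<close>

lemma sum_perm_weight_involutions:
  assumes X: "simple_graph X"
  shows "(\<Sum>p\<in>edge_involutions X. perm_weight (card (verts X)) p) = matching_poly X"
proof -
  have "matching_poly X = (\<Sum>p\<in>edge_involutions X. monom ((-1) ^ card {{v, p v} | v. p v \<noteq> v})
      (card (verts X) - 2 * card {{v, p v} | v. p v \<noteq> v}))"
    unfolding matching_poly_def
    by (rule sum.reindex_bij_betw[OF bij_betw_involutions_matchings[OF X], symmetric])
  also have "\<dots> = (\<Sum>p\<in>edge_involutions X. perm_weight (card (verts X)) p)"
    by (intro sum.cong refl) (simp add: perm_weight_def edge_involution_sign_card[OF X])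
  finally show ?thesis by (rule sym)
qed

lemma matching_card_le:
  assumes X: "simple_graph X" and M: "matching X M"
  shows "2 * card M \<le> card (verts X)"
proof -
  have "M \<in> (\<lambda>p. {{v, p v} | v. p v \<noteq> v}) ` edge_involutions X"
    unfolding bij_betw_imp_surj_on[OF bij_betw_involutions_matchings[OF X]] using M by simp
  then obtain p where p: "p \<in> edge_involutions X" "M = {{v, p v} | v. p v \<noteq> v}"
    by (rule imageE)
  have "{v. p v \<noteq> v} \<subseteq> verts X"
    using p(1) by (auto simp: edge_involutions_def edge_perms_def permutes_def)
  then show ?thesis
    using edge_involution_sign_card(2)[OF X p(1)] X p(2)
    by (metis card_mono simple_graph_def)
qed

lemma coeff_matching_poly:
  fixes X :: "'a ugraph"
  assumes X: "simple_graph X" and k: "2 * k \<le> card (verts X)"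
  shows "coeff (matching_poly X :: 'r::comm_ring_1 poly) (card (verts X) - 2 * k) =
    (-1) ^ k * of_nat (num_matchings X k)"
proof -
  \<comment> \<open>Neither difference is truncated, so the exponent determines the size of the
    matching.\<close>
  have iff: "card (verts X) - 2 * card M = card (verts X) - 2 * k \<longleftrightarrow> card M = k"
    if "matching X M" for M
    using matching_card_le[OF X that] k by auto
  have "coeff (matching_poly X :: 'r poly) (card (verts X) - 2 * k) =
    (\<Sum>M | matching X M. if card M = k then (-1) ^ k else 0)"
    unfolding matching_poly_def coeff_sum by (intro sum.cong refl) (auto simp: iff)
  also have "\<dots> = (\<Sum>M | matching X M \<and> card M = k. (-1) ^ k)"
    using sum.inter_filter[OF finite_matchings[OF X], of "\<lambda>_. (-1 :: 'r) ^ k" "\<lambda>M. card M = k"]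
    by simp
  also have "\<dots> = (-1) ^ k * of_nat (num_matchings X k)"
    unfolding sum_constant num_matchings_def by (rule mult.commute)
  finally show ?thesis .
qed

lemma coeff_matching_poly_0:
  assumes "\<And>M. matching X M \<Longrightarrow> card (verts X) - 2 * card M \<noteq> i"
  shows "coeff (matching_poly X :: 'r::comm_ring_1 poly) i = 0"
  unfolding matching_poly_def coeff_sum using assms by (intro sum.neutral) auto

lemma matching_number_ge:
  assumes "simple_graph X" "matching X M"
  shows "card M \<le> matching_number X"
  unfolding matching_number_def
  using finite_matchings[OF assms(1)] assms(2) by (intro Max_ge) (auto simp: setcompr_eq_image)

lemma ex_maximum_matching:
  assumes "simple_graph X"
  obtains M where "matching X M" "card M = matching_number X"
proof -
  have "matching X {}" by (simp add: matching_def)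
  then have "matching_number X \<in> {card M | M. matching X M}"
    unfolding matching_number_def
    using finite_matchings[OF assms] by (intro Max_in) (auto simp: setcompr_eq_image)
  then show ?thesis using that by auto
qed

lemma matching_number_le:
  assumes "simple_graph X"
  shows "2 * matching_number X \<le> card (verts X)"
  using ex_maximum_matching[OF assms] matching_card_le[OF assms] by metis

lemma num_matchings_pos_iff:
  assumes "simple_graph X"
  shows "0 < num_matchings X k \<longleftrightarrow> (\<exists>M. matching X M \<and> card M = k)"
  using finite_matchings[OF assms] by (auto simp: num_matchings_def card_gt_0_iff)

lemma num_matchings_eq_0:
  assumes "simple_graph X" "matching_number X < k"
  shows "num_matchings X k = 0"
  using num_matchings_pos_iff[OF assms(1), of k] matching_number_ge[OF assms(1)] assms(2) by force

section \<open>The unique cycle\<close>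

text \<open>The orbit of \<open>v\<close> under \<open>p\<close> runs along edges, and
  \<open>p (p v) \<noteq> v\<close> rules out lengths 1 and 2. The list \<open>support p v\<close>
  enumerates it in the order in which \<open>p\<close> traverses it.\<close>

lemma orbit_cycle:
  assumes X: "simple_graph X" and p: "p \<in> edge_perms X" and v: "p (p v) \<noteq> v"
  shows "cycle_in \<lparr>verts = set (support p v), edges = (\<lambda>w. {w, p w}) ` set (support p v)\<rparr> X"
proof -
  let ?k = "least_power p v" and ?S = "support p v"
  have perm: "permutation p"
    using p X permutation_permutes unfolding edge_perms_def simple_graph_def by blast
  note lp = least_power_of_permutation[OF perm, of v]
  have inj: "inj p" using perm by (simp add: permutation bij_is_inj)
  \<comment> \<open>A fixed point in the orbit would make \<open>v\<close> itself fixed, as powers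
    of \<open>p\<close> are injective.\<close>
  have moved: "p ((p ^^ i) v) \<noteq> (p ^^ i) v" for i
  proof
    assume "p ((p ^^ i) v) = (p ^^ i) v"
    then have "(p ^^ i) (p v) = (p ^^ i) v" by (simp add: funpow_swap1)
    then have "p v = v" using inj_fn[OF inj, of i] by (simp add: inj_eq)
    then show False using v by simp
  qed
  have "?k \<noteq> 1" "?k \<noteq> 2"
    using lp(1) v moved[of 0] by (auto simp: numeral_2_eq_2)
  then have len: "length ?S \<ge> 3" using lp(2) by simp
  \<comment> \<open>At the last position the index wraps to 0, matching
    \<open>(p ^^ ?k) v = v\<close>.\<close>
  have next_eq: "?S ! (Suc i mod length ?S) = p (?S ! i)" if "i < length ?S" for i
  proof (cases "Suc i = ?k")
    case True
    then have "p ((p ^^ i) v) = v" using lp(1) by (metis comp_apply funpow.simps(2))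
    then show ?thesis using True that lp(2) by simp
  qed (use that in simp)
  have edge: "{w, p w} \<in> edges X" if "w \<in> set ?S" for w
    using p moved that by (auto simp: edge_perms_def)
  have "set ?S \<subseteq> verts X"
  proof
    fix w assume "w \<in> set ?S"
    from edge[OF this] show "w \<in> verts X" using X by (auto simp: simple_graph_def)
  qed
  moreover have "(\<lambda>w. {w, p w}) ` set ?S = {{?S ! i, ?S ! (Suc i mod length ?S)} | i. i < length ?S}"
    (is "?L = ?R")
  proof -
    have "?R = (\<lambda>i. {?S ! i, ?S ! (Suc i mod length ?S)}) ` {..<length ?S}" by blast
    also have "\<dots> = (\<lambda>i. {?S ! i, p (?S ! i)}) ` {..<length ?S}"
      by (intro image_cong refl) (simp only: next_eq lessThan_iff)
    also have "\<dots> = ?L" by (simp add: image_image lessThan_atLeast0)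
    finally show ?thesis by (rule sym)
  qed
  moreover have "(\<lambda>w. {w, p w}) ` set ?S \<subseteq> edges X" using edge by blast
  ultimately show ?thesis
    using len cycle_of_permutation[OF perm, of v]
    unfolding cycle_in_def ugraph.select_convs
    by (intro conjI exI[of _ ?S]) (assumption | rule refl)+
qed

lemma char_poly_acyclic:
  assumes X: "simple_graph X" and acyclic: "\<nexists>C. cycle_in C X"
  shows "char_poly (adj_matrix X :: 'r::idom mat) = matching_poly X"
proof -
  have "edge_involutions X = edge_perms X"
    using orbit_cycle[OF X] acyclic by (auto simp: edge_involutions_def)
  then show ?thesis
    using sum_perm_weight_involutions[OF X] by (simp add: char_poly_adj_matrix[OF X])
qed

text \<open>\<open>c\<close> turns the cycle by one step in one of its two directions. The third
  condition separates the directions; in the last one, \<open>A\<close> consists of every other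
  vertex and will give a perfect matching.\<close>

definition rotation_of :: "'a ugraph \<Rightarrow> ('a \<Rightarrow> 'a) \<Rightarrow> bool" where
  "rotation_of C c \<longleftrightarrow>
     c permutes verts C \<and> edges C = (\<lambda>v. {v, c v}) ` verts C \<and>
     (\<forall>v\<in>verts C. c (c v) \<noteq> v) \<and> sign c = (-1) ^ (card (verts C) - 1) \<and>
     (even (card (verts C)) \<longrightarrow> (\<exists>A. A \<union> c ` A = verts C \<and> A \<inter> c ` A = {}))"

lemma ex_rotation_of:
  assumes C: "cycle_in C X"
  shows "\<exists>c. rotation_of C c"
proof -
  obtain vs where vs: "distinct vs" "length vs \<ge> 3" "verts C = set vs"
      "edges C = {{vs ! i, vs ! (Suc i mod length vs)} | i. i < length vs}"
    using C by (auto simp: cycle_in_def)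
  let ?n = "length vs"
  define c where "c = cycle_of_list vs"
  have c: "c (vs ! i) = vs ! (Suc i mod ?n)" if "i < ?n" for i
  proof -
    have "map c vs = rotate 1 vs"
      using cyclic_rotation[OF vs(1), of 1] by (simp add: c_def)
    then have "map c vs ! i = rotate 1 vs ! i" by simp
    then show ?thesis using that by (simp add: nth_rotate1)
  qed
  have "c permutes verts C" unfolding c_def vs(3) by (rule cycle_permutes)
  moreover have "edges C = (\<lambda>v. {v, c v}) ` verts C"
  proof -
    have "(\<lambda>v. {v, c v}) ` verts C = (\<lambda>i. {vs ! i, c (vs ! i)}) ` {..<?n}"
      unfolding vs(3) by (simp add: set_conv_nth image_image lessThan_def setcompr_eq_image)
    also have "\<dots> = (\<lambda>i. {vs ! i, vs ! (Suc i mod ?n)}) ` {..<?n}"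
      by (intro image_cong refl) (simp add: c)
    also have "\<dots> = edges C" unfolding vs(4) by blast
    finally show ?thesis by (rule sym)
  qed
  moreover have "c (c v) \<noteq> v" if v: "v \<in> verts C" for v
  proof -
    obtain i where i: "i < ?n" "v = vs ! i"
      using v unfolding vs(3) by (auto simp: in_set_conv_nth)
    have pos: "0 < ?n" using vs(2) by linarith
    then have "c (c v) = vs ! (Suc (Suc i) mod ?n)"
      using i by (simp add: c mod_Suc_eq)
    \<comment> \<open>Length at least 3 matters here: after wrapping around, two steps still end
      strictly before \<open>i\<close>.\<close>
    moreover have "Suc (Suc i) mod ?n \<noteq> i"
    proof (cases "Suc (Suc i) < ?n")
      case False
      then have "Suc (Suc i) mod ?n = Suc (Suc i) - ?n"
        using i(1) vs(2) by (simp add: le_mod_geq)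
      then have "Suc (Suc i) mod ?n < i" using i(1) vs(2) False by linarith
      then show ?thesis by simp
    qed simp
    ultimately show ?thesis using i vs(1) pos by (simp add: nth_eq_iff_index_eq)
  qed
  moreover have "sign c = (-1) ^ (card (verts C) - 1)"
  proof -
    \<comment> \<open>A cycle on \<open>k\<close> points is a product of \<open>k - 1\<close>
      transpositions; the recursion of \<open>cycle_of_list\<close> peels them off one at a
      time.\<close>
    have "sign (cycle_of_list xs) = (-1) ^ (length xs - 1)" if "distinct xs" for xs :: "'a list"
      using that
    proof (induction xs rule: cycle_of_list.induct)
      case (1 i j cs)
      have "sign (cycle_of_list (i # j # cs)) =
          sign (Transposition.transpose i j) * sign (cycle_of_list (j # cs))"
        unfolding cycle_of_list.simps(1)
        by (rule sign_compose[OF permutation_swap_id permutation_of_cycle])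
      then show ?case using 1 by (simp add: sign_swap_id del: cycle_of_list.simps)
    qed simp_all
    then show ?thesis unfolding c_def vs(3) using vs(1) by (simp add: distinct_card)
  qed
  moreover have "\<exists>A. A \<union> c ` A = verts C \<and> A \<inter> c ` A = {}" if even: "even (card (verts C))"
  proof -
    have n: "even ?n" using even vs(1,3) by (simp add: distinct_card)
    let ?E = "{i. i < ?n \<and> even i}" and ?O = "{i. i < ?n \<and> odd i}"
    \<comment> \<open>In an even cycle the last position is odd, so the successor of an even
      position never wraps around.\<close>
    have succ: "Suc i mod ?n = Suc i" if "i \<in> ?E" for i
    proof -
      have "Suc i \<noteq> ?n" using that n by (metis even_Suc mem_Collect_eq)
      then show ?thesis using that by simp
    qed
    have "Suc ` ?E = ?O"
    proof (intro equalityI subsetI)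
      fix j assume "j \<in> ?O"
      then have "j = Suc (j - 1)" "j - 1 \<in> ?E" by auto
      then show "j \<in> Suc ` ?E" by blast
    next
      fix j assume "j \<in> Suc ` ?E"
      then obtain i where i: "i \<in> ?E" "j = Suc i" by blast
      have "Suc i < ?n" using succ[OF i(1)] i(1) by (metis mod_less_divisor gr_implies_not0 mem_Collect_eq neq0_conv)
      then show "j \<in> ?O" using i by simp
    qed
    moreover have "c ` (!) vs ` ?E = (!) vs ` Suc ` ?E"
      unfolding image_image by (intro image_cong refl) (simp add: c succ)
    ultimately have cE: "c ` (!) vs ` ?E = (!) vs ` ?O" by simp
    have "(!) vs ` ?E \<union> (!) vs ` ?O = (!) vs ` {..<?n}" by (auto simp flip: image_Un)
    moreover have "(!) vs ` ?E \<inter> (!) vs ` ?O = {}"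
      using vs(1) by (auto simp: nth_eq_iff_index_eq)
    moreover have "(!) vs ` {..<?n} = verts C"
      unfolding vs(3) by (auto simp: set_conv_nth)
    ultimately show ?thesis using cE by (intro exI[of _ "(!) vs ` ?E"]) simp
  qed
  ultimately have "rotation_of C c" by (simp add: rotation_of_def)
  then show ?thesis by (intro exI[of _ c])
qed

text \<open>An edge permutation that is not an involution has \<open>C\<close> as its only orbit
  longer than 2. It therefore rotates \<open>C\<close> in one of two directions and acts as an
  involution, that is, a matching, on \<open>F\<close>.\<close>

lemma char_poly_unique_cycle:
  fixes X :: "'a ugraph"
  assumes X: "simple_graph X" and C: "cycle_in C X" and uniq: "\<And>D. cycle_in D X \<Longrightarrow> D = C"
  defines "F \<equiv> delete_verts X (verts C)"
  shows "char_poly (adj_matrix X :: 'r::idom mat) = matching_poly X - 2 * matching_poly F"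
proof -
  obtain c where "rotation_of C c" using ex_rotation_of[OF C] by blast
  then have c: "c permutes verts C" "edges C = (\<lambda>v. {v, c v}) ` verts C"
    "\<And>v. v \<in> verts C \<Longrightarrow> c (c v) \<noteq> v" "sign c = (-1) ^ (card (verts C) - 1)"
    by (simp_all add: rotation_of_def)
  let ?VC = "verts C"
  have sub: "?VC \<subseteq> verts X" "edges C \<subseteq> edges X" using C by (auto simp: cycle_in_def)
  have finX: "finite (verts X)" using X by (simp add: simple_graph_def)
  have finC: "finite ?VC" using finite_subset[OF sub(1) finX] .
  have "?VC \<noteq> {}" using C by (auto simp: cycle_in_def)
  then obtain v1 where v1: "v1 \<in> ?VC" by blast
  have F: "simple_graph F" using X by (auto simp: simple_graph_def F_def delete_verts_def)
  have VF: "verts F = verts X - ?VC" by (simp add: F_def delete_verts_def)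
  have EF: "edges F = {e \<in> edges X. e \<inter> ?VC = {}}" by (simp add: F_def delete_verts_def)
  have cin: "c w \<in> ?VC \<longleftrightarrow> w \<in> ?VC" for w using permutes_in_image[OF c(1)] .
  \<comment> \<open>The rotation in the opposite direction.\<close>
  define ci where "ci = inv_into UNIV c"
  have inv_c: "ci permutes ?VC" unfolding ci_def using permutes_inv[OF c(1)] .
  have cinv: "c (ci w) = w" "ci (c w) = w" for w
    using permutes_inverses[OF c(1)] by (auto simp: ci_def)
  have icin: "ci w \<in> ?VC \<longleftrightarrow> w \<in> ?VC" for w using permutes_in_image[OF inv_c] .

  have orient: "d permutes ?VC \<and> (\<forall>v\<in>?VC. {v, d v} \<in> edges C \<and> d (d v) \<noteq> v) \<and> sign d = sign c"
    if "d \<in> {c, ci}" for d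
  proof (cases "d = c")
    case True
    then show ?thesis using c by blast
  next
    case False
    then have d: "d = ci" using that by blast
    have "{v, ci v} \<in> edges C \<and> ci (ci v) \<noteq> v" if "v \<in> ?VC" for v
    proof
      have "{ci v, c (ci v)} \<in> edges C" unfolding c(2) using that icin by blast
      then show "{v, ci v} \<in> edges C" by (simp add: cinv insert_commute)
      show "ci (ci v) \<noteq> v" using c(3)[OF that] cinv by metis
    qed
    moreover have "sign (ci) = sign c"
      unfolding ci_def by (rule sign_inverse) (use c(1) finC permutation_permutes in blast)
    ultimately show ?thesis using d inv_c by blast
  qed

  have fixed_C: "q w = w" if "q \<in> edge_involutions F" "w \<notin> verts F" for q w
    using that by (auto simp: edge_involutions_def edge_perms_def permutes_not_in)
  have in_F: "q w \<in> verts F \<longleftrightarrow> w \<in> verts F" if "q \<in> edge_involutions F" for q w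
    using that permutes_in_image[of q "verts F" w] by (auto simp: edge_involutions_def edge_perms_def)
  \<comment> \<open>\<open>q\<close> fixes \<open>C\<close> pointwise and \<open>d\<close> fixes
    everything else, so the two act independently.\<close>
  have val: "(d \<circ> q) w = (if w \<in> ?VC then d w else q w)"
    if "d \<in> {c, ci}" "q \<in> edge_involutions F" for d q w
  proof (cases "w \<in> ?VC")
    case True
    then show ?thesis using fixed_C[OF that(2), of w] VF by simp
  next
    case False
    have "q w \<notin> ?VC"
    proof (cases "w \<in> verts F")
      case True
      then have "q w \<in> verts F" by (simp only: in_F[OF that(2)])
      then show ?thesis by (simp add: VF)
    qed (use fixed_C[OF that(2)] False in simp)
    moreover have "d permutes ?VC" using orient[OF that(1)] by blast
    ultimately show ?thesis using False by (simp add: permutes_not_in)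
  qed

  have noninv: "edge_perms X - edge_involutions X =
    (\<lambda>q. c \<circ> q) ` edge_involutions F \<union> (\<lambda>q. ci \<circ> q) ` edge_involutions F"
  proof (intro equalityI subsetI)
    fix p assume "p \<in> edge_perms X - edge_involutions X"
    then obtain v0 where p: "p \<in> edge_perms X" and v0: "p (p v0) \<noteq> v0"
      by (auto simp: edge_involutions_def)
    have pX: "p permutes verts X" and pe: "\<And>v. p v \<noteq> v \<Longrightarrow> {v, p v} \<in> edges X"
      using p by (auto simp: edge_perms_def)
    have perm: "permutation p" using pX finX permutation_permutes by blast
    have inj: "inj p" using pX by (rule permutes_inj)
    \<comment> \<open>Uniqueness of the cycle forces every orbit longer than 2, together with the
      edges it runs along, to be \<open>C\<close>.\<close>
    have orbit: "?VC = range (\<lambda>i. (p ^^ i) w)" "edges C = (\<lambda>w. {w, p w}) ` ?VC"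
      if "p (p w) \<noteq> w" for w
      using uniq[OF orbit_cycle[OF X p that]] support_set[OF perm, of w]
      by (metis ugraph.select_convs)+
    have inv_out: "p (p w) = w" if "w \<notin> ?VC" for w
    proof (rule ccontr)
      assume "p (p w) \<noteq> w"
      from orbit(1)[OF this] have "w \<in> ?VC" by (metis funpow_0 rangeI)
      with that show False by simp
    qed
    note orb = orbit[OF v0]
    have ppw: "p (p w) \<noteq> w" if w: "w \<in> ?VC" for w
    proof
      assume *: "p (p w) = w"
      obtain i where i: "w = (p ^^ i) v0" using w orb(1) by blast
      have "(p ^^ i) (p (p v0)) = (p ^^ i) v0" using * i by (simp add: funpow_swap1)
      then have "p (p v0) = v0" using inj_fn[OF inj, of i] by (simp add: inj_eq)
      then show False using v0 by simp
    qed
    have p_in: "p w \<in> ?VC" if w: "w \<in> ?VC" for w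
    proof -
      obtain i where i: "w = (p ^^ i) v0" using w orb(1) by blast
      have "p w = (p ^^ Suc i) v0" using i by simp
      then show ?thesis using orb(1) by blast
    qed
    have p_out: "p w \<notin> ?VC" if "w \<notin> ?VC" for w
      using p_in[of "p w"] inv_out[OF that] that by auto
    \<comment> \<open>Each edge of \<open>C\<close> joins a vertex to its
      \<open>c\<close>-successor, so \<open>p\<close> moves \<open>w\<close> one step forward or one
      step back.\<close>
    have either: "p w = c w \<or> c (p w) = w" if w: "w \<in> ?VC" for w
    proof -
      have "{w, p w} \<in> edges C" using orb(2) w by blast
      then obtain u where "{w, p w} = {u, c u}" using c(2) by blast
      then show ?thesis by (auto simp: doubleton_eq_iff)
    qed
    \<comment> \<open>The direction cannot change on the way: stepping forward and then back would
      give \<open>p (p w) = w\<close>.\<close>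
    have step: "p (p w) = c (p w)" if w: "w \<in> ?VC" and "p w = c w" for w
    proof (rule ccontr)
      assume "p (p w) \<noteq> c (p w)"
      then have "c (p (p w)) = c w" using either[OF p_in[OF w]] that(2) by simp
      then have "p (p w) = w" using permutes_inj[OF c(1)] by (simp add: inj_eq)
      then show False using ppw[OF w] by simp
    qed
    have "\<exists>d\<in>{c, ci}. \<forall>w\<in>?VC. p w = d w"
    proof (cases "\<exists>w\<in>?VC. p w = c w")
      case True
      then obtain w where w: "w \<in> ?VC" "p w = c w" by blast
      have "(p ^^ i) w \<in> ?VC \<and> p ((p ^^ i) w) = c ((p ^^ i) w)" for i
        using w step p_in by (induction i) (auto simp: cin)
      moreover have "?VC = range (\<lambda>i. (p ^^ i) w)" using orbit(1)[OF ppw[OF w(1)]] .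
      ultimately have "\<forall>w\<in>?VC. p w = c w" by auto
      then show ?thesis by blast
    next
      case False
      then have "c (p w) = w" if "w \<in> ?VC" for w using either that by blast
      then have "p w = ci w" if "w \<in> ?VC" for w using that cinv by metis
      then show ?thesis by blast
    qed
    then obtain d where d: "d \<in> {c, ci}" "\<And>w. w \<in> ?VC \<Longrightarrow> p w = d w" by blast
    \<comment> \<open>The part of \<open>p\<close> away from \<open>C\<close>; the rest is the
      rotation \<open>d\<close>.\<close>
    define q where "q w = (if w \<in> ?VC then w else p w)" for w
    have qq: "q (q w) = w" for w using inv_out p_out by (simp add: q_def)
    have "q permutes verts F"
    proof -
      have "q w = w" if "w \<notin> verts F" for w
        using that VF permutes_not_in[OF pX, of w] by (auto simp: q_def)
      then show ?thesis unfolding permutes_def using qq by metis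
    qed
    moreover have "{w, q w} \<in> edges F" if "q w \<noteq> w" for w
      using that pe[of w] p_out[of w] unfolding q_def EF by (auto split: if_splits)
    ultimately have q: "q \<in> edge_involutions F"
      using qq by (simp add: edge_involutions_def edge_perms_def)
    have "p = d \<circ> q"
      using val[OF d(1) q] d(2) by (auto simp: fun_eq_iff q_def)
    then show "p \<in> (\<lambda>q. c \<circ> q) ` edge_involutions F \<union> (\<lambda>q. ci \<circ> q) ` edge_involutions F"
      using d(1) q by blast
  next
    fix p assume "p \<in> (\<lambda>q. c \<circ> q) ` edge_involutions F \<union> (\<lambda>q. ci \<circ> q) ` edge_involutions F"
    then obtain d q where d: "d \<in> {c, ci}" and q: "q \<in> edge_involutions F" and p: "p = d \<circ> q"
      by blast
    note dd = orient[OF d]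
    have qF: "q permutes verts F" and qe: "\<And>v. q v \<noteq> v \<Longrightarrow> {v, q v} \<in> edges F"
      using q by (auto simp: edge_involutions_def edge_perms_def)
    have "p permutes verts X"
      unfolding p using permutes_subset[OF qF] permutes_subset[of d ?VC "verts X"] dd sub VF
      by (intro permutes_compose) auto
    moreover have "{w, p w} \<in> edges X" if "p w \<noteq> w" for w
    proof (cases "w \<in> ?VC")
      case True
      then show ?thesis using dd sub(2) val[OF d q, of w] by (auto simp: p)
    next
      case False
      then show ?thesis using that qe[of w] val[OF d q, of w] by (auto simp: p EF)
    qed
    moreover have "p (p v1) \<noteq> v1"
    proof -
      have "d v1 \<in> ?VC" using dd v1 permutes_in_image by fastforce
      then have "p (p v1) = d (d v1)"
        unfolding p val[OF d q] using v1 by simp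
      then show ?thesis using dd v1 by simp
    qed
    ultimately show "p \<in> edge_perms X - edge_involutions X"
      by (auto simp: edge_perms_def edge_involutions_def)
  qed

  have weight: "perm_weight (card (verts X)) (d \<circ> q) = - (perm_weight (card (verts F)) q :: 'r poly)"
    if d: "d \<in> {c, ci}" and q: "q \<in> edge_involutions F" for d q
  proof -
    note dd = orient[OF d]
    have dmove: "d v \<noteq> v" if "v \<in> ?VC" for v using dd that by metis
    have moved: "{v. (d \<circ> q) v \<noteq> v} = ?VC \<union> {v. q v \<noteq> v}"
      using dmove fixed_C[OF q] VF unfolding val[OF d q] by auto
    have sub_F: "{v. q v \<noteq> v} \<subseteq> verts F" using fixed_C[OF q] by blast
    have finF: "finite (verts F)" using F by (simp add: simple_graph_def)
    have fin: "finite {v. q v \<noteq> v}" using finite_subset[OF sub_F finF] .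
    have card: "card {v. (d \<circ> q) v \<noteq> v} = card ?VC + card {v. q v \<noteq> v}"
      unfolding moved using finC fin sub_F VF by (intro card_Un_disjoint) auto
    have cardF: "card (verts F) = card (verts X) - card ?VC"
      unfolding VF using finC sub(1) by (simp add: card_Diff_subset)
    have "q permutes verts F" using q by (simp add: edge_involutions_def edge_perms_def)
    then have perm_q: "permutation q" using finF permutation_permutes by blast
    have perm_d: "permutation d" using dd finC permutation_permutes by blast
    have "card ?VC \<noteq> 0" using v1 finC by auto
    \<comment> \<open>A rotation of \<open>Suc m\<close> vertices has sign \<open>(-1) ^ m\<close>,
      and its moved points contribute \<open>(-1) ^ Suc m\<close>. The product is \<open>-1\<close>
      for either parity, whence the minus sign.\<close>
    then obtain m where m: "card ?VC = Suc m" using not0_implies_Suc by blast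
    have "sign (d \<circ> q) = (-1) ^ m * sign q"
      using sign_compose[OF perm_d perm_q] dd c(4) m by simp
    then have "of_int (sign (d \<circ> q)) * (-1) ^ card {v. (d \<circ> q) v \<noteq> v} =
        - (of_int (sign q) * (-1 :: 'r) ^ card {v. q v \<noteq> v})"
      unfolding card m by (cases "even m") (simp_all add: power_add)
    then show ?thesis
      unfolding perm_weight_def card cardF minus_monom by simp
  qed

  have inj: "inj_on (\<lambda>q. d \<circ> q) A" if "d \<in> {c, ci}" for d and A :: "('a \<Rightarrow> 'a) set"
  proof -
    have "inj d" using orient[OF that] permutes_inj by blast
    then show ?thesis using fun.inj_map inj_on_subset by blast
  qed
  have disj: "(\<lambda>q. c \<circ> q) ` edge_involutions F \<inter> (\<lambda>q. ci \<circ> q) ` edge_involutions F = {}"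
  proof -
    have "c \<circ> q \<noteq> ci \<circ> q'" if "q \<in> edge_involutions F" "q' \<in> edge_involutions F" for q q'
    proof
      assume "c \<circ> q = ci \<circ> q'"
      then have "(c \<circ> q) v1 = (ci \<circ> q') v1" by simp
      moreover have "q v1 = v1" "q' v1 = v1"
        using fixed_C[OF that(1), of v1] fixed_C[OF that(2), of v1] v1 VF by simp_all
      ultimately have "c v1 = ci v1" by simp
      then have "c (c v1) = v1" by (simp add: cinv)
      then show False using c(3)[OF v1] by simp
    qed
    then show ?thesis by blast
  qed
  have finF: "finite (edge_involutions F)"
    using finite_edge_perms[OF F] by (simp add: edge_involutions_def)
  let ?w = "perm_weight (card (verts X)) :: ('a \<Rightarrow> 'a) \<Rightarrow> 'r poly"
  have part: "sum ?w ((\<lambda>q. d \<circ> q) ` edge_involutions F) = - matching_poly F"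
    if d: "d \<in> {c, ci}" for d
  proof -
    have "sum ?w ((\<lambda>q. d \<circ> q) ` edge_involutions F) = (\<Sum>q\<in>edge_involutions F. ?w (d \<circ> q))"
      by (simp add: sum.reindex[OF inj[OF d]])
    also have "\<dots> = - matching_poly F"
      by (simp add: weight[OF d] sum_negf sum_perm_weight_involutions[OF F])
    finally show ?thesis .
  qed
  have "char_poly (adj_matrix X :: 'r mat) = sum ?w (edge_perms X)"
    by (rule char_poly_adj_matrix[OF X])
  also have "\<dots> = sum ?w (edge_perms X - edge_involutions X) + sum ?w (edge_involutions X)"
    by (rule sum.subset_diff[OF _ finite_edge_perms[OF X]]) (simp add: edge_involutions_def)
  also have "sum ?w (edge_perms X - edge_involutions X) = - matching_poly F + - matching_poly F"
    unfolding noninv using finF by (subst sum.union_disjoint) (simp_all add: disj part)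
  finally show ?thesis by (simp add: sum_perm_weight_involutions[OF X])
qed

section \<open>Nullity\<close>

text \<open>The lowest nonzero coefficient of the matching polynomial belongs to the maximum
  matchings, and up to sign it counts them.\<close>

lemma nullity_acyclic:
  assumes X: "simple_graph X" and acyclic: "\<nexists>C. cycle_in C X"
  shows "nullity X = card (verts X) - 2 * matching_number X"
  unfolding nullity_eq_order char_poly_acyclic[OF X acyclic]
proof (rule order_0_eqI)
  fix k assume "k < card (verts X) - 2 * matching_number X"
  then show "coeff (matching_poly X :: real poly) k = 0"
    using matching_number_ge[OF X] by (intro coeff_matching_poly_0) fastforce
next
  have "0 < num_matchings X (matching_number X)"
    using ex_maximum_matching[OF X] num_matchings_pos_iff[OF X] by metis
  then show "coeff (matching_poly X :: real poly) (card (verts X) - 2 * matching_number X) \<noteq> 0"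
    by (simp add: coeff_matching_poly[OF X matching_number_le[OF X]])
qed

lemma perfect_matching_of_half:
  assumes c: "inj c" and half: "A \<union> c ` A = verts C" "A \<inter> c ` A = {}"
    and E: "edges C = (\<lambda>v. {v, c v}) ` verts C" and fin: "finite (verts C)"
  shows "matching C ((\<lambda>v. {v, c v}) ` A)" "\<Union>((\<lambda>v. {v, c v}) ` A) = verts C"
    "2 * card ((\<lambda>v. {v, c v}) ` A) = card (verts C)"
proof -
  have sep: "a \<noteq> c b" if "a \<in> A" "b \<in> A" for a b using half(2) that by blast
  have "inj_on (\<lambda>v. {v, c v}) A"
    using sep by (auto simp: inj_on_def doubleton_eq_iff)
  moreover have "card A + card (c ` A) = card (verts C)"
    using card_Un_disjoint[of A "c ` A"] half fin by (metis finite_Un)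
  moreover have "card (c ` A) = card A" using c by (simp add: card_image inj_on_subset)
  ultimately show "2 * card ((\<lambda>v. {v, c v}) ` A) = card (verts C)" by (simp add: card_image)
  show "\<Union>((\<lambda>v. {v, c v}) ` A) = verts C" unfolding half(1)[symmetric] by auto
  have "{v, c v} \<inter> {w, c w} = {}" if "v \<in> A" "w \<in> A" "{v, c v} \<noteq> {w, c w}" for v w
  proof -
    have "v \<noteq> w" using that(3) by blast
    moreover have "c v \<noteq> c w" using \<open>v \<noteq> w\<close> c by (simp add: inj_eq)
    ultimately show ?thesis using sep that(1,2) by auto
  qed
  moreover have "(\<lambda>v. {v, c v}) ` A \<subseteq> edges C" unfolding E using half(1) by blast
  ultimately show "matching C ((\<lambda>v. {v, c v}) ` A)" by (auto simp: matching_def)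
qed

lemma even_cycle_perfect_matchings:
  assumes C: "cycle_in C X" and card: "card (verts C) = 2 * l"
  obtains P Q where "matching C P" "\<Union>P = verts C" "card P = l"
    "matching C Q" "\<Union>Q = verts C" "card Q = l" "P \<noteq> Q"
proof -
  obtain c where "rotation_of C c" using ex_rotation_of[OF C] by blast
  then have c: "c permutes verts C" "edges C = (\<lambda>v. {v, c v}) ` verts C"
    "\<And>v. v \<in> verts C \<Longrightarrow> c (c v) \<noteq> v"
    "even (card (verts C)) \<Longrightarrow> \<exists>A. A \<union> c ` A = verts C \<and> A \<inter> c ` A = {}"
    by (simp_all add: rotation_of_def)
  obtain A where A: "A \<union> c ` A = verts C" "A \<inter> c ` A = {}"
    using c(4) card by auto
  have fin: "finite (verts C)" and ne: "verts C \<noteq> {}" using C by (auto simp: cycle_in_def)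
  have inj: "inj c" using permutes_inj[OF c(1)] .
  have "c ` A \<union> c ` c ` A = verts C"
    using permutes_image[OF c(1)] A(1) by (simp flip: image_Un)
  moreover have "c ` A \<inter> c ` c ` A = {}"
    using A(2) image_Int[OF inj, of A "c ` A"] by simp
  ultimately have B: "c ` A \<union> c ` c ` A = verts C" "c ` A \<inter> c ` c ` A = {}" .
  note P = perfect_matching_of_half[OF inj A c(2) fin]
  note Q = perfect_matching_of_half[OF inj B c(2) fin]
  let ?P = "(\<lambda>v. {v, c v}) ` A" and ?Q = "(\<lambda>v. {v, c v}) ` c ` A"
  have "?P \<noteq> ?Q"
  proof
    assume eq: "?P = ?Q"
    obtain a where a: "a \<in> A" using A(1) ne by blast
    then have "{a, c a} \<in> ?Q" using eq by blast
    then obtain b where b: "b \<in> A" "{a, c a} = {c b, c (c b)}" by blast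
    have "a \<noteq> c b" using A(2) a b(1) by blast
    then have "a = c (c b)" "c a = c b" using b(2) by (metis doubleton_eq_iff)+
    then have "c (c b) = b" using inj by (simp add: inj_eq)
    then show False using c(3)[of b] b(1) A(1) by blast
  qed
  moreover have "card ?P = l" "card ?Q = l" using P(3) Q(3) card by simp_all
  ultimately show ?thesis using P(1,2) Q(1,2) that by blast
qed

lemma matching_Un_delete_verts:
  assumes "matching X P" "matching (delete_verts X (\<Union>P)) M"
  shows "matching X (P \<union> M)"
proof -
  have P: "P \<subseteq> edges X" "\<And>e f. e \<in> P \<Longrightarrow> f \<in> P \<Longrightarrow> e \<noteq> f \<Longrightarrow> e \<inter> f = {}"
    and M: "M \<subseteq> edges X" "\<And>e f. e \<in> M \<Longrightarrow> f \<in> M \<Longrightarrow> e \<noteq> f \<Longrightarrow> e \<inter> f = {}"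
    using assms by (auto simp: matching_def delete_verts_def)
  have miss: "f \<inter> \<Union>P = {}" if "f \<in> M" for f
    using assms(2) that by (auto simp only: matching_def delete_verts_def ugraph.select_convs)
  have mixed: "e \<inter> f = {}" if "e \<in> P" "f \<in> M" for e f using miss[OF that(2)] that(1) by blast
  have "e \<inter> f = {}" if "e \<in> P \<union> M" "f \<in> P \<union> M" "e \<noteq> f" for e f
    using that P(2)[of e f] M(2)[of e f] mixed[of e f] mixed[of f e] by (auto simp only: Un_iff Int_commute)
  then show ?thesis using P(1) M(1) by (simp add: matching_def)
qed

section \<open>Matchings and nullity in the presence of an even cycle\<close>

context
  fixes X C :: "'a ugraph" and l :: nat and F :: "'a ugraph"
  assumes X: "simple_graph X" and C: "cycle_in C X" "card (verts C) = 2 * l"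
  defines "F \<equiv> delete_verts X (verts C)"
begin

lemma simple_graph_delete_cycle: "simple_graph F"
  using X by (auto simp: simple_graph_def F_def delete_verts_def)

text \<open>Edges of \<open>M\<close> avoid \<open>C\<close> and those of \<open>P\<close> meet it.
  The last claim recovers \<open>P\<close> from the union, which keeps extensions by different
  perfect matchings of \<open>C\<close> apart.\<close>

lemma matching_cycle_Un:
  assumes P: "matching C P" "\<Union>P = verts C" and M: "matching F M"
  shows "matching X (P \<union> M)" "card (P \<union> M) = card P + card M"
    "{e \<in> P \<union> M. e \<inter> verts C \<noteq> {}} = P"
proof -
  have PX: "matching X P"
    using P(1) C(1) by (auto simp: matching_def cycle_in_def)
  show "matching X (P \<union> M)"
    using matching_Un_delete_verts[OF PX] M P(2) by (simp add: F_def)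
  have ne: "e \<noteq> {}" if "e \<in> P" for e
  proof -
    have "card e = 2" using PX X that by (auto simp: matching_def simple_graph_def)
    then show ?thesis by auto
  qed
  have meet: "e \<inter> verts C \<noteq> {}" if "e \<in> P" for e using ne[OF that] P(2) that by blast
  have miss: "e \<inter> verts C = {}" if "e \<in> M" for e
    using M that by (auto simp: matching_def F_def delete_verts_def)
  show "{e \<in> P \<union> M. e \<inter> verts C \<noteq> {}} = P" using meet miss by blast
  have "P \<inter> M = {}" using meet miss by blast
  then show "card (P \<union> M) = card P + card M"
    using card_Un_disjoint matching_finite[OF X PX] matching_finite[OF simple_graph_delete_cycle M] by blast
qed

lemma matching_number_cycle_ge: "l + matching_number F \<le> matching_number X"
proof -
  obtain P Q where P: "matching C P" "\<Union>P = verts C" "card P = l"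
    "matching C Q" "\<Union>Q = verts C" "card Q = l" "P \<noteq> Q"
    by (rule even_cycle_perfect_matchings[OF C])
  obtain M where M: "matching F M" "card M = matching_number F"
    by (rule ex_maximum_matching[OF simple_graph_delete_cycle])
  show ?thesis
    using matching_number_ge[OF X matching_cycle_Un(1)[OF P(1,2) M(1)]] matching_cycle_Un(2)[OF P(1,2) M(1)]
      P(3) M(2) by simp
qed

text \<open>Each \<open>j\<close>-matching of \<open>F\<close> extends by either perfect matching of \<open>C\<close>. All matchings so
  obtained cover \<open>C\<close>, whereas a maximum matching of \<open>F\<close> together with a perfect matching of \<open>C\<close>
  minus one edge does not.\<close>

lemma twice_num_matchings_less:
  assumes l: "l > 0"
    and M0: "matching F M0" "card M0 = Suc j"
  shows "2 * num_matchings F j < num_matchings X (l + j)"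
proof -
  obtain P Q where P: "matching C P" "\<Union>P = verts C" "card P = l"
    and Q: "matching C Q" "\<Union>Q = verts C" "card Q = l" and PQ: "P \<noteq> Q"
    by (rule even_cycle_perfect_matchings[OF C])
  let ?S = "{M. matching F M \<and> card M = j}"
  let ?T = "{M. matching X M \<and> card M = l + j}"
  have finS: "finite ?S" using finite_matchings[OF simple_graph_delete_cycle] by simp
  have finT: "finite ?T" using finite_matchings[OF X] by simp
  have inj: "inj_on (\<lambda>M. R \<union> M) ?S" if R: "matching C R" "\<Union>R = verts C" for R
  proof (rule inj_onI)
    fix M M' assume M: "M \<in> ?S" and M': "M' \<in> ?S" and eq: "R \<union> M = R \<union> M'"
    have outside: "{e \<in> R \<union> N. e \<inter> verts C = {}} = N" if "N \<in> ?S" for N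
    proof -
      have N: "matching F N" using that by simp
      then have "e \<inter> verts C = {}" if "e \<in> N" for e
        using that by (auto simp: matching_def F_def delete_verts_def)
      moreover have "e \<inter> verts C \<noteq> {}" if "e \<in> R" for e
        using matching_cycle_Un(3)[OF R N] that by blast
      ultimately show ?thesis by blast
    qed
    show "M = M'" using outside[OF M] outside[OF M'] eq by simp
  qed
  have disj: "(\<lambda>M. P \<union> M) ` ?S \<inter> (\<lambda>M. Q \<union> M) ` ?S = {}"
  proof -
    have "P \<union> M \<noteq> Q \<union> M'" if M: "M \<in> ?S" and M': "M' \<in> ?S" for M M'
    proof
      assume "P \<union> M = Q \<union> M'"
      then have "P = Q"
        using matching_cycle_Un(3)[OF P(1,2), of M] matching_cycle_Un(3)[OF Q(1,2), of M'] M M' by simp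
      then show False using PQ by simp
    qed
    then show ?thesis by blast
  qed
  let ?U = "(\<lambda>M. P \<union> M) ` ?S \<union> (\<lambda>M. Q \<union> M) ` ?S"
  have subT: "?U \<subseteq> ?T"
    using matching_cycle_Un(1,2)[OF P(1,2)] matching_cycle_Un(1,2)[OF Q(1,2)] P(3) Q(3) by auto
  have cover: "verts C \<subseteq> \<Union>N" if "N \<in> ?U" for N using that P(2) Q(2) by auto
  obtain e where e: "e \<in> P" using P(3) l by (metis card.empty ex_in_conv less_irrefl)
  \<comment> \<open>Dropping \<open>e\<close> is compensated by the additional edge of
    \<open>M0\<close>, so the size is again \<open>l + j\<close>, but the ends of \<open>e\<close>
    stay uncovered.\<close>
  define N where "N = (P - {e}) \<union> M0"
  have PM: "matching X (P \<union> M0)" "card (P \<union> M0) = l + Suc j"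
    using matching_cycle_Un(1,2)[OF P(1,2) M0(1)] P(3) M0(2) by simp_all
  have meet: "e \<inter> verts C \<noteq> {}" using matching_cycle_Un(3)[OF P(1,2) M0(1)] e by blast
  have "e \<notin> M0" using meet M0(1) by (auto simp: matching_def F_def delete_verts_def)
  then have N: "N = (P \<union> M0) - {e}" by (auto simp: N_def)
  have "matching X N" using PM(1) unfolding N matching_def by blast
  moreover have "card N = l + j"
    unfolding N using PM(2) e matching_finite[OF X PM(1)] by simp
  ultimately have NT: "N \<in> ?T" by simp
  obtain v where v: "v \<in> e" "v \<in> verts C" using meet by blast
  have "v \<notin> \<Union>N"
  proof
    assume "v \<in> \<Union>N"
    then obtain f where f: "f \<in> N" "v \<in> f" by blast
    then have "f \<in> P \<union> M0" "e \<in> P \<union> M0" "e \<noteq> f" using e unfolding N by auto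
    then have "e \<inter> f = {}" using PM(1) by (auto simp: matching_def)
    then show False using f(2) v(1) by blast
  qed
  then have "N \<notin> ?U" using cover v(2) by blast
  have "2 * card ?S = card ?U"
    using card_Un_disjoint[OF finite_imageI[OF finS] finite_imageI[OF finS] disj]
      card_image[OF inj[OF P(1,2)]] card_image[OF inj[OF Q(1,2)]] by simp
  also have "\<dots> < card ?T"
    by (rule psubset_card_mono[OF finT]) (use subT NT \<open>N \<notin> ?U\<close> in blast)
  finally show ?thesis by (simp add: num_matchings_def)
qed

text \<open>The nullity is the lowest exponent with nonzero coefficient: the one belonging to
  \<open>\<nu>\<close>, or in the exceptional case the next one up. The additive form avoids
  truncated subtraction.\<close>

lemma nullity_unique_even_cycle:
  assumes uniq: "\<And>D. cycle_in D X \<Longrightarrow> D = C"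
  defines "exceptional \<equiv> matching_number X = l + matching_number F \<and> even l \<and>
    num_matchings X (matching_number X) = 2 * num_matchings F (matching_number F)"
  shows "nullity X + 2 * matching_number X = card (verts X) + (if exceptional then 2 else 0)"
proof -
  note F = simple_graph_delete_cycle
  let ?n = "card (verts X)" and ?nu = "matching_number X" and ?s = "matching_number F"
  let ?p = "char_poly (adj_matrix X) :: real poly"
  have "finite (verts C)" "verts C \<subseteq> verts X" "card (verts C) \<ge> 3"
    using C(1) by (auto simp: cycle_in_def distinct_card)
  then have cardF: "card (verts F) = ?n - 2 * l" and l: "l > 0" and "2 * l \<le> ?n"
    using C(2) X by (auto simp: F_def delete_verts_def card_Diff_subset simple_graph_def
        dest: card_mono)
  have nu: "l + ?s \<le> ?nu" "2 * ?nu \<le> ?n" "2 * ?s \<le> card (verts F)"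
    using matching_number_cycle_ge matching_number_le X F by auto
  have p: "coeff ?p i = coeff (matching_poly X) i - 2 * coeff (matching_poly F) i" for i
  proof -
    have "?p = matching_poly X - 2 * matching_poly F"
      unfolding F_def by (rule char_poly_unique_cycle[OF X C(1) uniq])
    then show ?thesis by (simp only: coeff_diff mult_2 coeff_add)
  qed
  have cX: "coeff (matching_poly X :: real poly) (?n - 2 * k) = (-1) ^ k * num_matchings X k"
    if "2 * k \<le> ?n" for k using coeff_matching_poly[OF X that] by simp
  \<comment> \<open>\<open>F\<close> has \<open>2 * l\<close> fewer vertices, so at the exponent of
    the \<open>k\<close>-matchings of \<open>X\<close> its polynomial counts matchings with
    \<open>k - l\<close> edges.\<close>
  have cF: "coeff (matching_poly F :: real poly) (?n - 2 * k) = (-1) ^ (k - l) * num_matchings F (k - l)"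
    if "2 * k \<le> ?n" "l \<le> k" for k
  proof -
    have "card (verts F) - 2 * (k - l) = ?n - 2 * k" "2 * (k - l) \<le> card (verts F)"
      using that by (simp_all add: cardF)
    then show ?thesis using coeff_matching_poly[OF F, of "k - l", where ?'r = real] by simp
  qed
  \<comment> \<open>A matching of \<open>F\<close> with \<open>j\<close> edges contributes at
    \<open>k = l + j\<close>, and this is at most \<open>?nu\<close> by
    \<open>matching_number_cycle_ge\<close>.\<close>
  have vanish: "coeff ?p i = 0" if "\<And>k. k \<le> ?nu \<Longrightarrow> i \<noteq> ?n - 2 * k" for i
  proof -
    have "coeff (matching_poly X :: real poly) i = 0"
    proof (rule coeff_matching_poly_0)
      fix M assume "matching X M"
      from that[OF matching_number_ge[OF X this]] show "?n - 2 * card M \<noteq> i" by simp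
    qed
    moreover have "coeff (matching_poly F :: real poly) i = 0"
    proof (rule coeff_matching_poly_0)
      fix M assume M: "matching F M"
      have "l + card M \<le> ?nu" using matching_number_ge[OF F M] nu(1) by simp
      from that[OF this] show "card (verts F) - 2 * card M \<noteq> i" by (simp add: cardF)
    qed
    ultimately show ?thesis by (simp add: p)
  qed
  obtain N where N: "matching X N" "card N = ?nu" by (rule ex_maximum_matching[OF X])
  have pos: "0 < num_matchings X ?nu" using N num_matchings_pos_iff[OF X] by blast
  have at_nu: "coeff ?p (?n - 2 * ?nu) =
      (-1) ^ ?nu * num_matchings X ?nu - 2 * ((-1) ^ (?nu - l) * num_matchings F (?nu - l))"
    unfolding p using cX cF nu by simp
  \<comment> \<open>If \<open>?nu\<close> exceeds \<open>l + ?s\<close>, then \<open>F\<close>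
    contributes nothing and the positive count for \<open>X\<close> survives. Otherwise
    \<open>(-1) ^ ?s\<close> factors out, and cancellation against a nonnegative count requires
    \<open>l\<close> to be even.\<close>
  have exc: "exceptional \<longleftrightarrow> coeff ?p (?n - 2 * ?nu) = 0"
  proof (cases "?nu = l + ?s")
    case True
    have "coeff ?p (?n - 2 * ?nu) =
        (-1) ^ ?s * ((-1) ^ l * num_matchings X ?nu - 2 * num_matchings F ?s)"
      unfolding at_nu unfolding True by (simp add: power_add algebra_simps)
    then have "coeff ?p (?n - 2 * ?nu) = 0 \<longleftrightarrow>
        (-1) ^ l * real (num_matchings X ?nu) = 2 * real (num_matchings F ?s)" by simp
    also have "\<dots> \<longleftrightarrow> even l \<and> num_matchings X ?nu = 2 * num_matchings F ?s"
      using pos by (cases "even l") auto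
    finally show ?thesis using True by (simp add: exceptional_def)
  next
    case False
    then have "num_matchings F (?nu - l) = 0" using nu(1) by (intro num_matchings_eq_0[OF F]) auto
    then show ?thesis using False pos by (simp add: exceptional_def at_nu)
  qed
  show ?thesis
  proof (cases exceptional)
    case False
    have "order 0 ?p = ?n - 2 * ?nu"
    proof (rule order_0_eqI)
      fix i assume "i < ?n - 2 * ?nu"
      then show "coeff ?p i = 0" by (intro vanish) auto
    qed (use exc False in simp)
    then show ?thesis using False nu(2) by (simp add: nullity_eq_order)
  next
    case True
    then have ex: "?nu = l + ?s" "even l" by (auto simp: exceptional_def)
    \<comment> \<open>Exponents go in steps of two, so once the coefficient for \<open>?nu\<close>
      vanishes the next candidate belongs to \<open>?nu - 1\<close>.\<close>
    define k where "k = ?nu - 1"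
    have k: "?nu = Suc k" using ex(1) l by (simp add: k_def)
    have "order 0 ?p = ?n - 2 * k"
    proof (rule order_0_eqI)
      fix i assume i: "i < ?n - 2 * k"
      show "coeff ?p i = 0"
      proof (cases "i = ?n - 2 * ?nu")
        case True
        then show ?thesis using exc \<open>exceptional\<close> by simp
      next
        case False
        have "i \<noteq> ?n - 2 * m" if "m \<le> ?nu" for m
          using i False that nu(2) unfolding k by (cases "m = Suc k") auto
        then show ?thesis by (rule vanish)
      qed
    next
      have "N \<noteq> {}" using N(2) k by auto
      then obtain e where "e \<in> N" by blast
      then have "matching X (N - {e})" "card (N - {e}) = k"
        using N k matching_finite[OF X N(1)] by (auto simp: matching_def)
      then have posk: "0 < num_matchings X k" using num_matchings_pos_iff[OF X] by blast
      have k_le: "2 * k \<le> ?n" using k nu(2) by simp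
      show "coeff ?p (?n - 2 * k) \<noteq> 0"
      \<comment> \<open>If \<open>?s\<close> is 0, then \<open>k = l - 1\<close> and
        \<open>F\<close> has no term at this exponent. Otherwise \<open>k - l = ?s - 1\<close>, and
        a maximum matching of \<open>F\<close> has the one extra edge needed for the strict
        inequality.\<close>
      proof (cases "?s")
        case 0
        have "coeff (matching_poly F :: real poly) (?n - 2 * k) = 0"
        proof (rule coeff_matching_poly_0)
          fix M assume M: "matching F M"
          show "card (verts F) - 2 * card M \<noteq> ?n - 2 * k"
            using matching_number_ge[OF F M] ex(1) k 0 nu \<open>2 * l \<le> ?n\<close> l unfolding cardF by auto
        qed
        then show ?thesis using posk by (simp add: p cX[OF k_le])
      next
        case (Suc j)
        have kj: "k = l + j" using ex(1) k Suc by simp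
        obtain M0 where "matching F M0" "card M0 = Suc j"
          using ex_maximum_matching[OF F] Suc by metis
        from twice_num_matchings_less[OF l this]
        have less: "2 * num_matchings F j < num_matchings X (l + j)" .
        have "coeff ?p (?n - 2 * k) =
            (-1) ^ j * (real (num_matchings X (l + j)) - real (2 * num_matchings F j))"
          unfolding p cX[OF k_le] using cF[OF k_le] ex(2) by (simp add: kj power_add algebra_simps)
        moreover have "real (num_matchings X (l + j)) - real (2 * num_matchings F j) \<noteq> 0"
          using less by linarith
        ultimately show ?thesis by simp
      qed
    qed
    then show ?thesis using True k nu(2) by (simp add: nullity_eq_order)
  qed
qed

end

theorem proposition4p7:
  fixes T :: "'a ugraph" and H R U C F :: "'b ugraph" and l s :: nat
  assumes T: "simple_graph T" "tree_graph T" "main_factor_multiplicity T = 2"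
    and R: "simple_graph R" "tree_graph R"
    and U: "simple_graph U" "unicyclic U" "bipartite U"
    and H: "verts R \<inter> verts U = {}" "H = graph_union R U"
      "\<not> connected_graph H" "generalized_cospectral H T"
    and C: "cycle_in C U" "card (verts C) = 2 * l" "l \<ge> 2"
    and F: "F = delete_verts U (verts C)"
    and s: "s = matching_number F"
  shows "(int (nullity U) \<in>
       {int (card (verts U)) - 2 * int (matching_number U),
        int (card (verts U)) - 2 * int (matching_number U) + 2}) \<and>
     (int (matching_number T) - int (matching_number R) \<in>
       {int (matching_number U), int (matching_number U) - 1}) \<and>
     (int (nullity U) = int (card (verts U)) - 2 * int (matching_number U) + 2 \<longleftrightarrow>
       matching_number U = l + s \<and> even l \<and>
       num_matchings U (matching_number U) = 2 * num_matchings F s) \<and>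
     (int (matching_number T) - int (matching_number R) = int (matching_number U) - 1 \<longleftrightarrow>
       matching_number U = l + s \<and> even l \<and>
       num_matchings U (matching_number U) = 2 * num_matchings F s) \<and>
     (\<not> (matching_number U = l + s \<and> even l \<and>
        num_matchings U (matching_number U) = 2 * num_matchings F s) \<longrightarrow>
       int (matching_number T) - int (matching_number R) = int (matching_number U))"
proof -
  have uniq: "D = C" if "cycle_in D U" for D
    using U(2) C(1) that by (auto simp: unicyclic_def)
  let ?exc = "matching_number U = l + s \<and> even l \<and>
     num_matchings U (matching_number U) = 2 * num_matchings F s"
  have nU: "nullity U + 2 * matching_number U = card (verts U) + (if ?exc then 2 else 0)"
    unfolding s F by (rule nullity_unique_even_cycle[OF U(1) C(1,2) uniq])
  have nT: "nullity T + 2 * matching_number T = card (verts T)"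
    using nullity_acyclic[OF T(1)] T(2) matching_number_le[OF T(1)] by (simp add: tree_graph_def)
  have nR: "nullity R + 2 * matching_number R = card (verts R)"
    using nullity_acyclic[OF R(1)] R(2) matching_number_le[OF R(1)] by (simp add: tree_graph_def)
  have spec: "adj_spectrum H = adj_spectrum T" using H(4) by (simp add: generalized_cospectral_def)
  have "card (verts H) = card (verts R) + card (verts U)"
    using R(1) U(1) H(1,2) by (simp add: graph_union_def card_Un_disjoint simple_graph_def)
  \<comment> \<open>Only the sizes of the two spectra are compared here.\<close>
  then have nV: "card (verts T) = card (verts R) + card (verts U)"
    using spec size_adj_spectrum by metis
  have "nullity H = nullity T" using spec by (simp add: nullity_def)
  then have nH: "nullity T = nullity R + nullity U"
    using nullity_graph_union[OF R(1) U(1) H(1)] H(2) by simp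
  \<comment> \<open>Subtracting the equation for \<open>R\<close> from that for \<open>T\<close>
    leaves \<open>2 * (\<nu>(T) - \<nu>(R)) = |V(U)| - \<eta>(U)\<close>, and \<open>nU\<close>
    evaluates the right-hand side in both cases.\<close>
  show ?thesis using nU nT nR nV nH by (cases ?exc) auto
qed

end
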